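(* Let $\mathbf{X}\subseteq\Sigma^{\mathbb{Z}^2}$ be a countable subshift of finite type. Then $\mathbf{X}$ contains a configuration without any direction of periodicity if and only if $\mathbf{X}$ contains a configuration at level $2$ for $\preceq$.
   Context: $\Sigma$ is a finite alphabet; a configuration is an element of $\Sigma^{\mathbb{Z}^2}$. For $v\in\mathbb{Z}^2$ the shift $\sigma_v$ is defined by $\sigma_v(x)(a)=x(a-v)$. A configuration $x$ has (admits) a direction of periodicity if $\sigma_v(x)=x$ for some $v\neq(0,0)$. A pattern is an element $P\in\Sigma^V$ with $V\subset\mathbb{Z}^2$ finite; $P$ appears in a configuration $c$ if there is $v\in\mathbb{Z}^2$ with $c(a+v)=P(a)$ for all $a\in V$. A subshift is the set of all configurations in which no pattern of a given set $\mathcal{F}$ of patterns appears; it is of finite type (an SFT) if it can be so defined with $\mathcal{F}$ finite. Write $x\preceq y$ if every pattern appearing in $x$ appears in $y$; $x\approx y$ if $x\preceq y$ and $y\preceq x$; $x\prec y$ if $x\preceq y$ and not $x\approx y$. The level of $c\in\mathbf{X}$ is the length of the longest strictly decreasing chain for $\preceq$ in $\mathbf{X}$ starting at $c$, where a chain $c=c_0\succ c_1\succ\dots\succ c_n$ has length $n$ (so level $0$ means minimal for $\preceq$); if such chains can be arbitrarily long, $c$ has infinite level. *)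

theory Defs
  imports Main "HOL-Library.Product_Plus" "HOL-Library.Countable_Set" "HOL-Library.Extended_Nat"
begin

type_synonym 'a config = "int \<times> int \<Rightarrow> 'a"

text \<open>A pattern over a finite support \<open>V\<close> is a finite partial map with domain \<open>V\<close>.\<close>

type_synonym 'a pattern = "int \<times> int \<rightharpoonup> 'a"

definition is_pattern :: "'a pattern \<Rightarrow> bool" where
  "is_pattern P \<longleftrightarrow> finite (dom P)"

definition shift :: "int \<times> int \<Rightarrow> 'a config \<Rightarrow> 'a config" where
  "shift v x = (\<lambda>a. x (a - v))"

definition has_period_direction :: "'a config \<Rightarrow> bool" where
  "has_period_direction x \<longleftrightarrow> (\<exists>v. v \<noteq> (0, 0) \<and> shift v x = x)"

definition appears_in :: "'a pattern \<Rightarrow> 'a config \<Rightarrow> bool" where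
  "appears_in P c \<longleftrightarrow> (\<exists>v. \<forall>a \<in> dom P. P a = Some (c (a + v)))"

definition avoiding :: "'a pattern set \<Rightarrow> 'a config set" where
  "avoiding F = {x. \<forall>P \<in> F. \<not> appears_in P x}"

definition subshift_of_finite_type :: "'a config set \<Rightarrow> bool" where
  "subshift_of_finite_type X \<longleftrightarrow>
     (\<exists>F. finite F \<and> (\<forall>P \<in> F. is_pattern P) \<and> X = avoiding F)"

definition pat_le :: "'a config \<Rightarrow> 'a config \<Rightarrow> bool"  (infix "\<preceq>" 50) where
  "x \<preceq> y \<longleftrightarrow> (\<forall>P. is_pattern P \<longrightarrow> appears_in P x \<longrightarrow> appears_in P y)"

definition pat_equiv :: "'a config \<Rightarrow> 'a config \<Rightarrow> bool"  (infix "\<approx>" 50) where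
  "x \<approx> y \<longleftrightarrow> x \<preceq> y \<and> y \<preceq> x"

definition pat_less :: "'a config \<Rightarrow> 'a config \<Rightarrow> bool"  (infix "\<prec>" 50) where
  "x \<prec> y \<longleftrightarrow> x \<preceq> y \<and> \<not> x \<approx> y"

text \<open>A chain of length \<open>n\<close> has \<open>n + 1\<close> members \<open>s 0, \<dots>, s n\<close>; later values of \<open>s\<close> are irrelevant.\<close>

definition decreasing_chain ::
    "'a config set \<Rightarrow> 'a config \<Rightarrow> nat \<Rightarrow> (nat \<Rightarrow> 'a config) \<Rightarrow> bool" where
  "decreasing_chain X c n s \<longleftrightarrow>
     s 0 = c \<and> (\<forall>i \<le> n. s i \<in> X) \<and> (\<forall>i < n. s (Suc i) \<prec> s i)"

text \<open>The supremum is \<open>\<infinity>\<close> when chains from \<open>c\<close> are arbitrarily long. The value is meaningful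
  only for \<open>c \<in> X\<close>: otherwise there are no chains and the supremum is \<open>0\<close>.\<close>

definition level :: "'a config set \<Rightarrow> 'a config \<Rightarrow> enat" where
  "level X c = (SUP n \<in> {n. \<exists>s. decreasing_chain X c n s}. enat n)"

end

theory Submission imports Defs "HOL-Library.FuncSet" begin

text \<open>
  Two facts about countable subshifts of finite type relate levels to periods. The first concerns a configuration
  \<open>y\<close> of a countable subshift of finite type \<open>X\<close> that has a period \<open>v\<close>. It behaves like a
  configuration of a countable one-dimensional subshift of finite type: some strip along \<open>v\<close>
  recurs, and if the stretches between its recurrences could be combined freely they would yield
  uncountably many configurations of \<open>X\<close>; hence \<open>y\<close> is doubly periodic far away on each side of
  a line along \<open>v\<close> (\<open>periodic_eventually_periodic\<close>). So everything below \<open>y\<close> is a translate of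
  \<open>y\<close> or doubly periodic, and doubly periodic configurations are minimal. Chains from \<open>y\<close> have
  length at most 1 (\<open>periodic_no_chain\<close>), and a configuration at level 2 is aperiodic.

  The second is that an aperiodic \<open>c \<in> X\<close> has a configuration below it that is not doubly
  periodic (\<open>ex_below_not_doubly_periodic\<close>). Otherwise \<open>c\<close> would coincide, outside a finite
  region, with a single doubly periodic configuration \<open>w\<close>, and the defect of \<open>c\<close> could be pasted
  into \<open>w\<close> at arbitrary sets of sparse places, giving uncountably many configurations.

  It remains to find, once \<open>X\<close> has some aperiodic configuration, an aperiodic \<open>c\<close> below which
  everything is periodic: then some \<open>y \<prec> c\<close> is periodic without being doubly periodic, it is not
  minimal, and the level of \<open>c\<close> is exactly 2. Descending in the order could go on for ever, and a
  limit of aperiodic configurations may be periodic, so the descent is carried out for a property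
  that survives decreasing intersections. Call a set \<open>Y\<close> of configurations uniformly periodic
  if, for some radius \<open>r\<close> and some finite set \<open>V\<close> of nonzero vectors, each configuration all of
  whose \<open>r\<close>-windows occur in \<open>Y\<close> has a period in \<open>V\<close>. By compactness \<open>X\<close> contains a minimal
  subshift \<open>T\<close> that is not uniformly periodic, and the point is that \<open>T\<close> contains an aperiodic
  configuration \<open>c\<close> (\<open>minimal_contains_aperiodic\<close>). An aperiodic configuration strictly below
  \<open>c\<close> would generate a smaller subshift of the same kind, so \<open>c\<close> is as required.

  Why \<open>T\<close> contains an aperiodic configuration: suppose all its configurations are periodic. As
  \<open>T\<close> is countable and compact, its isolated configurations are dense. By minimality they have
  periods in one finite set. If \<open>x\<close> looks locally like \<open>T\<close> without having certain
  periods, every window of \<open>T\<close> recurs in \<open>x\<close>, and the window that isolates a configuration with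
  period \<open>v\<close> can only be continued as prescribed, so that it spreads along a whole strip in
  direction \<open>v\<close>. Strips in different directions would cross, which is impossible; hence all
  isolated configurations have a common period, by density so does all of \<open>T\<close>, and therefore
  everything that looks locally like \<open>T\<close>: a contradiction.
\<close>

section \<open>Windows and shifts\<close>

text \<open>Vectors of the plane are treated as elements of an additive group, so quantifiers over them
  are kept whole instead of being split into two integer quantifiers.\<close>

declare split_paired_All [simp del] split_paired_Ex [simp del]

definition box :: "nat \<Rightarrow> (int \<times> int) set" where
  "box n = {a. \<bar>fst a\<bar> \<le> int n \<and> \<bar>snd a\<bar> \<le> int n}"

definition agree :: "nat \<Rightarrow> 'a config \<Rightarrow> 'a config \<Rightarrow> bool" where
  "agree n x y \<longleftrightarrow> (\<forall>a \<in> box n. x a = y a)"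

lemma in_box: "a \<in> box n \<longleftrightarrow> \<bar>fst a\<bar> \<le> int n \<and> \<bar>snd a\<bar> \<le> int n"
  by (simp add: box_def)

lemma finite_box [simp]: "finite (box n)"
proof -
  have "box n \<subseteq> {- int n..int n} \<times> {- int n..int n}" by (auto simp: box_def)
  then show ?thesis by (rule finite_subset) simp
qed

lemma ex_in_box: "\<exists>k. v \<in> box k"
  by (rule exI[of _ "nat (max \<bar>fst v\<bar> \<bar>snd v\<bar>)"]) (auto simp: in_box)

lemma box_mono: "m \<le> n \<Longrightarrow> a \<in> box m \<Longrightarrow> a \<in> box n"
  by (auto simp: in_box)

lemma box_add: "a \<in> box m \<Longrightarrow> b \<in> box n \<Longrightarrow> a + b \<in> box (m + n)"
  by (auto simp: in_box)

lemma box_diff: "a \<in> box m \<Longrightarrow> b \<in> box n \<Longrightarrow> a - b \<in> box (m + n)"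
  by (auto simp: in_box)

lemma box_uminus [simp]: "- a \<in> box m \<longleftrightarrow> a \<in> box m"
  by (auto simp: in_box)

lemma finite_subset_box:
  assumes "finite A"
  shows "\<exists>k. A \<subseteq> box k"
  using assms
proof (induction rule: finite_induct)
  case (insert a A)
  then obtain k where "A \<subseteq> box k" by blast
  moreover obtain l where "a \<in> box l" using ex_in_box by blast
  ultimately have "insert a A \<subseteq> box (max k l)"
    using box_mono[of k "max k l"] box_mono[of l "max k l"] by auto
  then show ?case by blast
qed simp

lemma agree_refl [simp]: "agree n x x"
  by (simp add: agree_def)

lemma agree_sym: "agree n x y \<Longrightarrow> agree n y x"
  by (simp add: agree_def)

lemma agree_trans: "agree n x y \<Longrightarrow> agree n y z \<Longrightarrow> agree n x z"
  by (simp add: agree_def)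

lemma agree_mono: "agree n x y \<Longrightarrow> m \<le> n \<Longrightarrow> agree m x y"
  by (meson agree_def box_mono)

lemma agree_all_eq: "(\<And>n. agree n x y) \<Longrightarrow> x = y"
  by (metis agree_def ex_in_box ext)

lemma not_agree_above: "x \<noteq> y \<Longrightarrow> \<exists>n \<ge> m. \<not> agree n x y"
  by (meson agree_all_eq agree_mono nat_le_linear)

lemma shift_apply: "shift v x a = x (a - v)"
  by (simp add: shift_def)

lemma shift_shift [simp]: "shift u (shift v x) = shift (u + v) x"
  by (auto simp: shift_def algebra_simps)

lemma shift_0 [simp]: "shift 0 x = x"
  by (simp add: shift_def)

lemma shift_inject [simp]: "shift p x = shift p y \<longleftrightarrow> x = y"
  by (metis add.left_inverse shift_0 shift_shift)

text \<open>A shift by a vector of \<open>box k\<close> costs \<open>k\<close> in the radius of agreement.\<close>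

lemma agree_shift: "agree n x y \<Longrightarrow> p \<in> box k \<Longrightarrow> m + k \<le> n \<Longrightarrow> agree m (shift p x) (shift p y)"
  unfolding agree_def shift_apply
proof
  fix a assume *: "\<forall>a \<in> box n. x a = y a" "p \<in> box k" "m + k \<le> n" "a \<in> box m"
  have "a - p \<in> box n" using box_mono[OF *(3) box_diff[OF *(4,2)]] .
  then show "x (a - p) = y (a - p)" using *(1) by blast
qed

lemma shift_uminus_period: "shift v x = x \<Longrightarrow> shift (- v) x = x"
  by (metis add.left_inverse shift_0 shift_shift)

lemma period_iff: "shift v x = x \<longleftrightarrow> (\<forall>a. x (a + v) = x a)"
  by (metis add_diff_cancel diff_add_cancel shift_def ext)

lemma period_shift_iff: "shift v (shift p x) = shift p x \<longleftrightarrow> shift v x = x"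
proof -
  have "shift v (shift p x) = shift p (shift v x)" by (simp add: add.commute)
  then show ?thesis by (simp only: shift_inject)
qed

definition scale :: "int \<Rightarrow> int \<times> int \<Rightarrow> int \<times> int" where
  "scale k v = (k * fst v, k * snd v)"

text \<open>Up to a factor, \<open>det v a\<close> measures on which side of the line along \<open>v\<close> the point \<open>a\<close> lies and
  how far from it; it serves as the coordinate across that line.\<close>

definition det :: "int \<times> int \<Rightarrow> int \<times> int \<Rightarrow> int" where
  "det v a = fst v * snd a - snd v * fst a"

lemma fst_scale [simp]: "fst (scale k v) = k * fst v"
  and snd_scale [simp]: "snd (scale k v) = k * snd v"
  by (simp_all add: scale_def)

lemma scale_0 [simp]: "scale 0 v = 0"
  by (simp add: prod_eq_iff)

lemma scale_add: "scale (j + k) v = scale j v + scale k v"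
  by (simp add: prod_eq_iff algebra_simps)

lemma scale_1 [simp]: "scale 1 v = v"
  by (simp add: prod_eq_iff)

lemma scale_minus: "scale (j - k) v = scale j v - scale k v"
  by (simp add: prod_eq_iff algebra_simps)

lemma scale_eq_0: "scale k v = 0 \<longleftrightarrow> k = 0 \<or> v = 0"
  by (auto simp: prod_eq_iff)

lemma det_add: "det v (a + b) = det v a + det v b"
  and det_diff: "det v (a - b) = det v a - det v b"
  and det_scale: "det v (scale k a) = k * det v a"
  and det_self [simp]: "det v v = 0"
  and det_uminus: "det (- v) a = - det v a"
  by (simp_all add: det_def algebra_simps)

lemma period_scale:
  assumes "shift v x = x"
  shows "shift (scale k v) x = x"
proof (induction k rule: int_induct[where k = 0])
  case (step1 i)
  then show ?case by (metis scale_add scale_1 shift_shift assms)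
next
  case (step2 i)
  then show ?case
    by (metis scale_minus scale_1 shift_shift assms shift_uminus_period add_uminus_conv_diff)
qed simp

section \<open>Compactness and isolated configurations\<close>

text \<open>The least radius of a box containing \<open>a\<close>. A limit of a sequence of configurations is read off
  at \<open>a\<close> from a member that has already settled on this box.\<close>

definition size_of :: "int \<times> int \<Rightarrow> nat" where
  "size_of a = nat (max \<bar>fst a\<bar> \<bar>snd a\<bar>)"

lemma in_box_size_of: "a \<in> box n \<longleftrightarrow> size_of a \<le> n"
  by (auto simp: in_box size_of_def)

lemma infinite_agreeing_subset:
  fixes s :: "nat \<Rightarrow> ('a :: finite) config"
  assumes "infinite I"
  shows "\<exists>J \<subseteq> I. infinite J \<and> (\<forall>i \<in> J. \<forall>j \<in> J. agree n (s i) (s j))"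
proof -
  have "(\<lambda>i. restrict (s i) (box n)) ` I \<subseteq> PiE (box n) (\<lambda>_. UNIV)" by auto
  then have "finite ((\<lambda>i. restrict (s i) (box n)) ` I)"
    by (rule finite_subset) (simp add: finite_PiE)
  then obtain i where i: "i \<in> I"
      "infinite {j \<in> I. restrict (s j) (box n) = restrict (s i) (box n)}"
    using pigeonhole_infinite[OF assms] by blast
  have "agree n (s j) (s i)" if "restrict (s j) (box n) = restrict (s i) (box n)" for j
    unfolding agree_def using that by (metis restrict_apply')
  then show ?thesis
    using i by (intro exI[of _ "{j \<in> I. restrict (s j) (box n) = restrict (s i) (box n)}"])
      (auto intro: agree_trans agree_sym)
qed

text \<open>Koenig's lemma: by the pigeonhole principle, infinite index sets can be thinned out so that the
  windows of radius \<open>n\<close> become constant, successively for all \<open>n\<close>; the limit is read off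
  along the diagonal.\<close>

lemma compactness:
  fixes s :: "nat \<Rightarrow> ('a :: finite) config"
  shows "\<exists>y. \<forall>n. \<exists>m \<ge> n. agree n y (s m)"
proof -
  have "\<exists>I. \<forall>n. (infinite (I n) \<and> (\<forall>i \<in> I n. \<forall>j \<in> I n. agree n (s i) (s j))) \<and> I (Suc n) \<subseteq> I n"
  proof (rule dependent_nat_choice)
    show "\<exists>J. infinite J \<and> (\<forall>i \<in> J. \<forall>j \<in> J. agree 0 (s i) (s j))"
      using infinite_agreeing_subset[of UNIV 0 s] by auto
    show "\<exists>J. (infinite J \<and> (\<forall>i \<in> J. \<forall>j \<in> J. agree (Suc n) (s i) (s j))) \<and> J \<subseteq> I"
      if "infinite I \<and> (\<forall>i \<in> I. \<forall>j \<in> I. agree n (s i) (s j))" for I n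
      using infinite_agreeing_subset[of I "Suc n" s] that by blast
  qed
  then obtain I where inf: "\<And>n. infinite (I n)"
    and ag: "\<And>n i j. i \<in> I n \<Longrightarrow> j \<in> I n \<Longrightarrow> agree n (s i) (s j)"
    and dec: "\<And>n. I (Suc n) \<subseteq> I n" by metis
  have dec': "I n \<subseteq> I m" if "m \<le> n" for m n
    using lift_Suc_antimono_le[of I, OF dec that] .
  have "\<forall>n. \<exists>m. m \<ge> n \<and> m \<in> I n"
    using inf by (meson infinite_nat_iff_unbounded_le)
  then obtain r where r: "\<And>n. r n \<ge> n" "\<And>n. r n \<in> I n" by metis
  have "agree n (\<lambda>a. s (r (size_of a)) a) (s (r n))" for n
    unfolding agree_def
  proof
    fix a assume "a \<in> box n"
    then have "size_of a \<le> n" by (simp add: in_box_size_of)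
    then have "r n \<in> I (size_of a)" using dec' r(2) by blast
    from ag[OF r(2) this] show "s (r (size_of a)) a = s (r n) a"
      by (simp add: agree_def in_box_size_of)
  qed
  then show ?thesis using r(1) by blast
qed

definition closed_under_limits :: "'a config set \<Rightarrow> bool" where
  "closed_under_limits Y \<longleftrightarrow> (\<forall>y. (\<forall>n. \<exists>z \<in> Y. agree n y z) \<longrightarrow> y \<in> Y)"

definition subshift :: "'a config set \<Rightarrow> bool" where
  "subshift Y \<longleftrightarrow> closed_under_limits Y \<and> (\<forall>y \<in> Y. \<forall>p. shift p y \<in> Y)"

lemma closedD: "closed_under_limits Y \<Longrightarrow> (\<And>n. \<exists>z \<in> Y. agree n y z) \<Longrightarrow> y \<in> Y"
  by (simp add: closed_under_limits_def)

lemma subshift_closed: "subshift Y \<Longrightarrow> closed_under_limits Y"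
  and subshift_shift: "subshift Y \<Longrightarrow> y \<in> Y \<Longrightarrow> shift p y \<in> Y"
  by (simp_all add: subshift_def)

text \<open>This is how countability is used throughout. A set without isolated members allows two different
  continuations of each finite window, one of which avoids any given configuration; running through
  an enumeration of \<open>X\<close> produces in the limit a configuration of \<open>X\<close> that was not enumerated.\<close>

lemma ex_isolated:
  fixes X :: "'a config set"
  assumes X: "closed_under_limits X" "countable X" and A: "A \<subseteq> X" "A \<noteq> {}"
  shows "\<exists>x \<in> A. \<exists>n. \<forall>z \<in> A. agree n x z \<longrightarrow> z = x"
proof (rule ccontr)
  assume "\<not> ?thesis"
  then have perfect: "\<And>x n. x \<in> A \<Longrightarrow> \<exists>z \<in> A. agree n x z \<and> z \<noteq> x" by blast
  define e where "e = from_nat_into X"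
  have e: "range e = X" unfolding e_def using X(2) A by (intro range_from_nat_into) auto
  have "\<exists>f. \<forall>i. (case f i of (x, n) \<Rightarrow> x \<in> A \<and> i \<le> n) \<and>
     (case (f i, f (Suc i)) of ((x, n), (x', n')) \<Rightarrow>
        agree n x x' \<and> n \<le> n' \<and> \<not> agree n' x' (e i))"
  proof (rule dependent_nat_choice)
    show "\<exists>f. case f of (x, n) \<Rightarrow> x \<in> A \<and> (0::nat) \<le> n" using A by auto
    fix g :: "'a config \<times> nat" and i
    assume "case g of (x, n) \<Rightarrow> x \<in> A \<and> i \<le> n"
    then obtain x n where g: "g = (x, n)" "x \<in> A" "i \<le> n" by (cases g) auto
    obtain z where z: "z \<in> A" "agree n x z" "z \<noteq> x" using perfect[OF g(2)] by blast
    have "\<exists>w \<in> A. agree n x w \<and> w \<noteq> e i"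
      using z g(2) by (cases "x = e i") (blast intro: agree_refl)+
    then obtain w where w: "w \<in> A" "agree n x w" "w \<noteq> e i" by blast
    obtain n' where "n' \<ge> Suc n" "\<not> agree n' w (e i)" using not_agree_above[OF w(3)] by blast
    then show "\<exists>f. (case f of (x, n) \<Rightarrow> x \<in> A \<and> Suc i \<le> n) \<and>
       (case (g, f) of ((x, n), (x', n')) \<Rightarrow> agree n x x' \<and> n \<le> n' \<and> \<not> agree n' x' (e i))"
      using w g by (intro exI[of _ "(w, n')"]) auto
  qed
  then obtain f where f: "\<forall>i. (case f i of (x, n) \<Rightarrow> x \<in> A \<and> i \<le> n) \<and>
     (case (f i, f (Suc i)) of ((x, n), (x', n')) \<Rightarrow>
        agree n x x' \<and> n \<le> n' \<and> \<not> agree n' x' (e i))" ..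
  define x n where "x = fst \<circ> f" and "n = snd \<circ> f"
  have xA: "x i \<in> A" and ni: "i \<le> n i" and ag: "agree (n i) (x i) (x (Suc i))"
    and nn: "n i \<le> n (Suc i)" and ne: "\<not> agree (n (Suc i)) (x (Suc i)) (e i)" for i
    using f[rule_format, of i] by (auto simp: x_def n_def split: prod.splits)
  have nmono: "n i \<le> n j" if "i \<le> j" for i j
    using lift_Suc_mono_le[of n, OF nn that] .
  have agl: "agree (n i) (x i) (x j)" if "i \<le> j" for i j
    using that
  proof (induction rule: dec_induct)
    case (step j)
    then show ?case using agree_mono[OF ag nmono] agree_trans by fastforce
  qed simp
  define y where "y = (\<lambda>a. x (size_of a) a)"
  have yx: "agree (n i) y (x i)" for i
    unfolding agree_def
  proof
    fix a assume a: "a \<in> box (n i)"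
    show "y a = x i a"
    proof (cases "size_of a \<le> i")
      case True
      have "a \<in> box (n (size_of a))" using ni by (simp add: in_box_size_of)
      then show ?thesis using agl[OF True] by (simp add: y_def agree_def)
    next
      case False
      then show ?thesis using agl[of i "size_of a"] a by (simp add: y_def agree_def)
    qed
  qed
  have "y \<in> X"
    using X(1) by (rule closedD) (meson A(1) agree_mono ni subsetD xA yx)
  then obtain i where "y = e i" using e by blast
  then show False using yx[of "Suc i"] ne[of i] agree_sym by blast
qed

text \<open>Compactness for decreasing sequences of closed sets: the windows of a fixed radius are finite in
  number, so a window missing from the intersection is already missing from some member.\<close>

lemma decreasing_closed_windows:
  fixes Y :: "nat \<Rightarrow> ('a :: finite) config set"
  assumes cl: "\<And>n. closed_under_limits (Y n)" and dec: "\<And>n. Y (Suc n) \<subseteq> Y n"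
  shows "\<exists>N. \<forall>y \<in> Y N. \<exists>z \<in> (\<Inter>n. Y n). agree r y z"
proof (rule ccontr)
  define I where "I = (\<Inter>n. Y n)"
  assume "\<not> ?thesis"
  then have "\<forall>N. \<exists>y. y \<in> Y N \<and> (\<forall>z \<in> I. \<not> agree r y z)" unfolding I_def[symmetric] by blast
  then obtain s where s: "\<forall>N. s N \<in> Y N \<and> (\<forall>z \<in> I. \<not> agree r (s N) z)"
    by (rule choice[THEN exE])
  obtain y where y: "\<And>n. \<exists>m \<ge> n. agree n y (s m)" using compactness[of s] by blast
  have dec': "Y n \<subseteq> Y m" if "m \<le> n" for m n
    using lift_Suc_antimono_le[of Y, OF dec that] .
  have "y \<in> Y n" for n
  proof (rule closedD[OF cl])
    fix k
    obtain m where m: "m \<ge> max n k" "agree (max n k) y (s m)" using y by blast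
    then have "s m \<in> Y n" using s dec'[of n m] by auto
    moreover have "agree k y (s m)" using m(2) by (rule agree_mono) simp
    ultimately show "\<exists>z \<in> Y n. agree k y z" by blast
  qed
  then have "y \<in> I" by (simp add: I_def)
  moreover obtain m where "agree r y (s m)" using y by blast
  ultimately show False using s agree_sym by metis
qed

section \<open>Configurations that look locally like a subshift\<close>

definition locally_in :: "nat \<Rightarrow> 'a config \<Rightarrow> 'a config set \<Rightarrow> bool" where
  "locally_in r x Y \<longleftrightarrow> (\<forall>p. \<exists>y \<in> Y. agree r (shift p x) y)"

lemma locally_in_mono: "locally_in r x Y \<Longrightarrow> q \<le> r \<Longrightarrow> Y \<subseteq> Z \<Longrightarrow> locally_in q x Z"
  unfolding locally_in_def by (meson agree_mono subsetD)

lemma locally_in_shift: "locally_in r x Y \<Longrightarrow> locally_in r (shift p x) Y"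
  by (simp add: locally_in_def)

lemma locally_in_self: "subshift Y \<Longrightarrow> y \<in> Y \<Longrightarrow> locally_in r y Y"
  unfolding locally_in_def using agree_refl subshift_shift by blast

lemma closed_locally_in: "closed_under_limits {x. locally_in r x Y}"
  unfolding closed_under_limits_def
proof (intro allI impI, unfold mem_Collect_eq locally_in_def, intro allI)
  fix y p assume *: "\<forall>n. \<exists>z \<in> {x. \<forall>p. \<exists>y \<in> Y. agree r (shift p x) y}. agree n y z"
  obtain k where "p \<in> box k" using ex_in_box by blast
  moreover obtain z where z: "agree (r + k) y z" "\<exists>y \<in> Y. agree r (shift p z) y"
    using *[rule_format, of "r + k"] by blast
  ultimately have "agree r (shift p y) (shift p z)" using agree_shift by blast
  then show "\<exists>y' \<in> Y. agree r (shift p y) y'" using z(2) agree_trans by blast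
qed

lemma locally_in_all:
  assumes "closed_under_limits Y" "\<And>r. locally_in r x Y"
  shows "x \<in> Y"
  using assms(1) by (rule closedD) (metis assms(2) locally_in_def shift_0)

text \<open>The uniformity is over configurations that only look like \<open>Y\<close> at a fixed scale, which makes the
  negation stable under decreasing intersections; having only periodic members is not stable in
  that sense.\<close>

definition uniformly_periodic :: "'a config set \<Rightarrow> bool" where
  "uniformly_periodic Y \<longleftrightarrow> (\<exists>r V. finite V \<and> 0 \<notin> V \<and>
     (\<forall>x. locally_in r x Y \<longrightarrow> (\<exists>v \<in> V. shift v x = x)))"

lemma uniformly_periodic_empty: "uniformly_periodic {}"
  unfolding uniformly_periodic_def by (intro exI[of _ 0] exI[of _ "{}"]) (simp add: locally_in_def)

lemma uniformly_periodic_mono: "uniformly_periodic Z \<Longrightarrow> Y \<subseteq> Z \<Longrightarrow> uniformly_periodic Y"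
  unfolding uniformly_periodic_def by (meson locally_in_mono order_refl)

lemma uniformly_periodic_Inter:
  fixes Y :: "nat \<Rightarrow> ('a :: finite) config set"
  assumes Y: "\<And>n. closed_under_limits (Y n)" "\<And>n. Y (Suc n) \<subseteq> Y n"
    and up: "uniformly_periodic (\<Inter>n. Y n)"
  shows "\<exists>n. uniformly_periodic (Y n)"
proof -
  obtain r V where rV: "finite V" "0 \<notin> V"
      "\<And>x. locally_in r x (\<Inter>n. Y n) \<Longrightarrow> \<exists>v \<in> V. shift v x = x"
    using up unfolding uniformly_periodic_def by blast
  obtain N where "\<forall>y \<in> Y N. \<exists>z \<in> (\<Inter>n. Y n). agree r y z"
    using decreasing_closed_windows[of Y r] Y by blast
  then have "locally_in r x (\<Inter>n. Y n)" if "locally_in r x (Y N)" for x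
    using that unfolding locally_in_def by (meson agree_trans)
  then show ?thesis unfolding uniformly_periodic_def using rV by blast
qed

text \<open>The largest subshift of \<open>Y\<close> from which the window of \<open>w\<close> of radius \<open>n\<close> is banned.\<close>

definition without_window :: "'a config set \<Rightarrow> nat \<Rightarrow> 'a config \<Rightarrow> 'a config set" where
  "without_window Y n w = {y \<in> Y. \<forall>p. \<not> agree n w (shift p y)}"

lemma subshift_without_window:
  assumes "subshift Y"
  shows "subshift (without_window Y n w)"
  unfolding subshift_def
proof
  show "closed_under_limits (without_window Y n w)"
    unfolding closed_under_limits_def
  proof (intro allI impI)
    fix y assume *: "\<forall>n'. \<exists>z \<in> without_window Y n w. agree n' y z"
    have "\<exists>z \<in> Y. agree n' y z" for n'
      using *[rule_format, of n'] by (auto simp: without_window_def)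
    then have "y \<in> Y" using closedD[OF subshift_closed[OF assms]] by blast
    moreover have "\<not> agree n w (shift p y)" for p
    proof
      assume ag: "agree n w (shift p y)"
      obtain k where k: "p \<in> box k" using ex_in_box by blast
      obtain z where z: "z \<in> without_window Y n w" "agree (n + k) y z" using * by blast
      then have "agree n w (shift p z)" using agree_trans[OF ag agree_shift[OF z(2) k]] by simp
      then show False using z(1) by (simp add: without_window_def)
    qed
    ultimately show "y \<in> without_window Y n w" by (simp add: without_window_def)
  qed
  show "\<forall>y \<in> without_window Y n w. \<forall>p. shift p y \<in> without_window Y n w"
    using subshift_shift[OF assms] by (auto simp: without_window_def)
qed

section \<open>Minimal subshifts that are not uniformly periodic\<close>

definition minimal_not_uniformly_periodic :: "'a config set \<Rightarrow> bool" where
  "minimal_not_uniformly_periodic T \<longleftrightarrow> subshift T \<and> \<not> uniformly_periodic T \<and>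
     (\<forall>L. subshift L \<longrightarrow> L \<subseteq> T \<longrightarrow> L \<noteq> T \<longrightarrow> uniformly_periodic L)"

text \<open>There are countably many windows of configurations of \<open>X\<close>. They are banned one after the other
  whenever the rest is still not uniformly periodic; what survives is minimal because a smaller
  subshift would omit one of the windows, which would then have been banned.\<close>

lemma ex_minimal_not_uniformly_periodic:
  fixes X :: "('a :: finite) config set"
  assumes X: "subshift X" "countable X" "\<not> uniformly_periodic X"
  shows "\<exists>T \<subseteq> X. minimal_not_uniformly_periodic T"
proof -
  have "X \<noteq> {}" using X(3) uniformly_periodic_empty by metis
  define e where "e = from_nat_into (X \<times> (UNIV :: nat set))"
  have e: "range e = X \<times> UNIV" unfolding e_def
    using X(2) \<open>X \<noteq> {}\<close> by (intro range_from_nat_into) auto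
  let ?cut = "\<lambda>T i. without_window T (snd (e i)) (fst (e i))"
  define T where "T = rec_nat X (\<lambda>i S. if uniformly_periodic (?cut S i) then S else ?cut S i)"
  have T0: "T 0 = X" by (simp add: T_def)
  have TSuc: "T (Suc i) = (if uniformly_periodic (?cut (T i) i) then T i else ?cut (T i) i)" for i
    by (simp add: T_def)
  have dec: "T (Suc i) \<subseteq> T i" for i by (auto simp: TSuc without_window_def)
  have sub: "subshift (T i) \<and> \<not> uniformly_periodic (T i)" for i
    by (induction i) (use X in \<open>auto simp: T0 TSuc subshift_without_window\<close>)
  let ?I = "\<Inter>i. T i"
  have "\<not> uniformly_periodic ?I"
  proof
    assume "uniformly_periodic ?I"
    then have "\<exists>n. uniformly_periodic (T n)"
      using uniformly_periodic_Inter[of T] sub dec subshift_closed by metis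
    then show False using sub by blast
  qed
  moreover have "subshift ?I"
    unfolding subshift_def
  proof
    show "closed_under_limits ?I"
      unfolding closed_under_limits_def
    proof (intro allI impI INT_I)
      fix y i assume "\<forall>n. \<exists>z \<in> ?I. agree n y z"
      then show "y \<in> T i" using closedD[OF subshift_closed, of "T i" y] sub by blast
    qed
    show "\<forall>y \<in> ?I. \<forall>p. shift p y \<in> ?I" using subshift_shift sub by blast
  qed
  moreover have "uniformly_periodic L" if L: "subshift L" "L \<subseteq> ?I" "L \<noteq> ?I" for L
  proof (rule ccontr)
    assume nup: "\<not> uniformly_periodic L"
    obtain y where y: "y \<in> ?I" "y \<notin> L" using L by blast
    then have "\<not> (\<forall>n. \<exists>z \<in> L. agree n y z)"
      using subshift_closed[OF L(1)] unfolding closed_under_limits_def by (metis (no_types))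
    then obtain n where n: "\<forall>z \<in> L. \<not> agree n y z" by blast
    have "y \<in> X" using y(1) T0 by blast
    then have "(y, n) \<in> range e" by (simp add: e)
    then obtain i where i: "e i = (y, n)" by (metis imageE)
    have "L \<subseteq> ?cut (T i) i"
      using L n subshift_shift[OF L(1)] by (auto simp: i without_window_def)
    then have "T (Suc i) = ?cut (T i) i" using nup uniformly_periodic_mono TSuc by metis
    then have "y \<notin> T (Suc i)"
      by (simp add: i without_window_def) (metis agree_refl shift_0)
    then show False using y(1) by blast
  qed
  moreover have "?I \<subseteq> X" using T0 by blast
  ultimately show ?thesis unfolding minimal_not_uniformly_periodic_def by blast
qed

lemma minimal_without_window:
  assumes T: "minimal_not_uniformly_periodic T" and y: "y \<in> T"
  shows "uniformly_periodic (without_window T n y)"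
proof -
  have "agree n y (shift 0 y)" by simp
  then have "y \<notin> without_window T n y" unfolding without_window_def by blast
  then have "without_window T n y \<noteq> T" using y by auto
  moreover have "without_window T n y \<subseteq> T" by (auto simp: without_window_def)
  moreover have "subshift (without_window T n y)"
    using T by (simp add: minimal_not_uniformly_periodic_def subshift_without_window)
  ultimately show ?thesis using T by (simp add: minimal_not_uniformly_periodic_def)
qed

text \<open>Banning a window of \<open>T\<close> yields a uniformly periodic subshift. A configuration that looks like
  \<open>T\<close> at a large scale and omits the window looks, by compactness, like that smaller subshift at
  the scale of its uniformity, and so has one of finitely many periods.\<close>

lemma minimal_window_recurs:
  fixes T :: "('a :: finite) config set"
  assumes T: "minimal_not_uniformly_periodic T" and y: "y \<in> T"
  shows "\<exists>R V. finite V \<and> 0 \<notin> V \<and>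
    (\<forall>x. locally_in R x T \<longrightarrow> (\<forall>v \<in> V. shift v x \<noteq> x) \<longrightarrow> (\<exists>p. agree n y (shift p x)))"
proof -
  let ?Z = "without_window T n y"
  have sub: "subshift T" using T by (simp add: minimal_not_uniformly_periodic_def)
  have "uniformly_periodic ?Z" using T y by (rule minimal_without_window)
  then obtain r V where V: "finite V" "0 \<notin> V"
      "\<And>x. locally_in r x ?Z \<Longrightarrow> \<exists>v \<in> V. shift v x = x"
    unfolding uniformly_periodic_def by blast
  define Y where "Y R = without_window {x. locally_in R x T} n y" for R
  have subL: "subshift {x. locally_in R x T}" for R
    by (simp add: subshift_def closed_locally_in locally_in_shift)
  have subY: "subshift (Y R)" for R
    unfolding Y_def using subL by (rule subshift_without_window)
  have dec: "Y (Suc R) \<subseteq> Y R" for R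
    unfolding Y_def without_window_def using locally_in_mono[of "Suc R" _ T R T] by auto
  obtain N where N: "\<forall>x \<in> Y N. \<exists>z \<in> (\<Inter>R. Y R). agree r x z"
    using decreasing_closed_windows[of Y r] subY subshift_closed dec by metis
  have "z \<in> ?Z" if "z \<in> (\<Inter>R. Y R)" for z
  proof -
    have "locally_in R z T" for R using that by (auto simp: Y_def without_window_def)
    then have "z \<in> T" using locally_in_all[OF subshift_closed[OF sub]] by blast
    then show ?thesis using that by (auto simp: Y_def without_window_def)
  qed
  then have N': "\<forall>x \<in> Y N. \<exists>z \<in> ?Z. agree r x z" using N by meson
  have "\<exists>p. agree n y (shift p x)" if x: "locally_in N x T" "\<forall>v \<in> V. shift v x \<noteq> x" for x
  proof (rule ccontr)
    assume "\<nexists>p. agree n y (shift p x)"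
    then have "x \<in> Y N" using x(1) by (simp add: Y_def without_window_def)
    then have "locally_in r x ?Z"
      unfolding locally_in_def using subshift_shift[OF subY] N' by blast
    then show False using V(3) x(2) by blast
  qed
  then show ?thesis using V(1,2) by blast
qed

text \<open>If \<open>x\<close> looks like \<open>T\<close> at a scale exceeding the isolating window of \<open>y\<close> by the period \<open>v\<close>,
  then around an occurrence of that window \<open>x\<close> can only continue as \<open>y\<close>. By periodicity the
  continuation contains the same window moved by \<open>v\<close> and by \<open>- v\<close>, from where it spreads on.\<close>

lemma isolated_propagates:
  assumes isol: "\<forall>z \<in> T. agree n y z \<longrightarrow> z = y" and x: "locally_in R x T"
    and v: "shift v y = y" "v \<in> box k" "n + k \<le> R"
    and p: "agree n y (shift p x)"
  shows "agree R y (shift (p + scale j v) x)"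
proof -
  have grow: "agree R y (shift q x)" if q: "agree n y (shift q x)" for q
  proof -
    obtain z where z: "z \<in> T" "agree R (shift q x) z" using x unfolding locally_in_def by blast
    then have "agree n y z" using agree_mono[OF z(2), of n] agree_trans[OF q] v(3) by simp
    then show ?thesis using isol z agree_sym by blast
  qed
  have step: "agree R y (shift (q + u) x)"
    if q: "agree R y (shift q x)" and u: "shift u y = y" "u \<in> box k" for q u
    using agree_shift[OF q u(2) v(3)] u(1) by (simp add: grow add.commute)
  show ?thesis
  proof (induction j rule: int_induct[where k = 0])
    case base
    then show ?case using grow[OF p] by simp
  next
    case (step1 i)
    then show ?case using step[OF step1(2) v(1,2)] by (simp add: scale_add add.assoc)
  next
    case (step2 i)
    have "shift (- v) y = y" "- v \<in> box k" using v by (simp_all add: shift_uminus_period)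
    from step[OF step2(2) this] show ?case by (simp add: scale_minus add_diff_eq)
  qed
qed

text \<open>Reduction modulo the lattice spanned by \<open>u\<close> and \<open>v\<close>: Cramer's rule gives the rational
  coordinates of \<open>p\<close>, and what is left after removing their integral parts is bounded.\<close>

lemma lattice_reduction:
  assumes "det u v \<noteq> 0" and uv: "u \<in> box k" "v \<in> box l"
  shows "\<exists>i j. p + scale i u + scale j v \<in> box (k + l)"
proof -
  let ?D = "det u v"
  define \<alpha> \<beta> where "\<alpha> = det p v" and "\<beta> = det u p"
  have cramer: "?D * fst p = \<alpha> * fst u + \<beta> * fst v" "?D * snd p = \<alpha> * snd u + \<beta> * snd v"
    by (simp_all add: \<alpha>_def \<beta>_def det_def algebra_simps)
  define q where "q = p + scale (- (\<alpha> div ?D)) u + scale (- (\<beta> div ?D)) v"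
  have \<alpha>: "\<alpha> mod ?D = \<alpha> - ?D * (\<alpha> div ?D)" and \<beta>: "\<beta> mod ?D = \<beta> - ?D * (\<beta> div ?D)"
    by (simp_all add: minus_mult_div_eq_mod)
  have "?D * fst q = ?D * fst p - (?D * (\<alpha> div ?D)) * fst u - (?D * (\<beta> div ?D)) * fst v"
    "?D * snd q = ?D * snd p - (?D * (\<alpha> div ?D)) * snd u - (?D * (\<beta> div ?D)) * snd v"
    by (simp_all add: q_def algebra_simps)
  then have q: "?D * fst q = (\<alpha> mod ?D) * fst u + (\<beta> mod ?D) * fst v"
    "?D * snd q = (\<alpha> mod ?D) * snd u + (\<beta> mod ?D) * snd v"
    unfolding cramer \<alpha> \<beta> by (simp_all add: algebra_simps)
  have bound: "\<bar>m\<bar> \<le> int k + int l"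
    if "?D * m = (\<alpha> mod ?D) * a + (\<beta> mod ?D) * b" "\<bar>a\<bar> \<le> int k" "\<bar>b\<bar> \<le> int l" for m a b
  proof -
    have "\<bar>?D\<bar> * \<bar>m\<bar> \<le> \<bar>\<alpha> mod ?D\<bar> * \<bar>a\<bar> + \<bar>\<beta> mod ?D\<bar> * \<bar>b\<bar>"
      using that(1) by (metis abs_mult abs_triangle_ineq)
    also have "\<dots> \<le> \<bar>?D\<bar> * int k + \<bar>?D\<bar> * int l"
      using abs_mod_less[of ?D \<alpha>] abs_mod_less[of ?D \<beta>] assms(1) that
      by (intro add_mono mult_mono) auto
    finally have "\<bar>?D\<bar> * \<bar>m\<bar> \<le> \<bar>?D\<bar> * (int k + int l)" by (simp add: algebra_simps)
    then show ?thesis using assms(1) by simp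
  qed
  have "q \<in> box (k + l)"
    using bound[OF q(1)] bound[OF q(2)] uv by (simp add: in_box)
  then show ?thesis unfolding q_def by blast
qed

text \<open>With two independent periods the isolating window spreads over the whole plane, so a configuration
  close to \<open>T\<close> would inherit the period \<open>u\<close>, although it can be chosen without it.\<close>

lemma isolated_not_doubly_periodic:
  fixes T :: "('a :: finite) config set"
  assumes T: "minimal_not_uniformly_periodic T" and y: "y \<in> T"
    and isol: "\<forall>z \<in> T. agree n y z \<longrightarrow> z = y"
    and uv: "shift u y = y" "shift v y = y" "det u v \<noteq> 0"
  shows False
proof -
  obtain R V where V: "finite V" "0 \<notin> V"
    "\<And>x. locally_in R x T \<Longrightarrow> (\<forall>v \<in> V. shift v x \<noteq> x) \<Longrightarrow> \<exists>p. agree n y (shift p x)"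
    using minimal_window_recurs[OF T y, of n] by blast
  obtain k l where k: "u \<in> box k" and l: "v \<in> box l" using ex_in_box by metis
  define R' where "R' = max R (n + k + k + l)"
  have u0: "0 \<notin> insert u V" using V uv(3) by (auto simp: det_def)
  obtain x where x: "locally_in R' x T" "\<forall>w \<in> insert u V. shift w x \<noteq> x"
    using T u0 V(1) unfolding minimal_not_uniformly_periodic_def uniformly_periodic_def
    by (metis finite_insert)
  have "locally_in R x T" using x(1) by (rule locally_in_mono) (simp_all add: R'_def)
  then obtain p where p: "agree n y (shift p x)" using V(3) x(2) by blast
  have "agree R' y (shift (p + scale i u) x)" for i
    using isolated_propagates[OF isol x(1) uv(1) k _ p] by (simp add: R'_def)
  then have ag: "agree R' y (shift (p + scale i u + scale j v) x)" for i j
    using isolated_propagates[OF isol x(1) uv(2) l, of "p + scale i u"] agree_mono[of R' y _ n]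
    by (simp add: R'_def)
  have "x (a - u) = x a" for a
  proof -
    obtain i j where ij: "a + p + scale i u + scale j v \<in> box (k + l)"
      using lattice_reduction[OF uv(3) k l] by blast
    define q where "q = p + scale i u + scale j v"
    have aq: "a + q \<in> box (k + l)" using ij by (simp add: q_def add.assoc)
    have in_R': "a + q \<in> box R'" "a + q - u \<in> box R'"
      using box_mono[OF _ aq, of R'] box_mono[OF _ box_diff[OF aq k], of R'] by (simp_all add: R'_def)
    have "y b = x (b - q)" if "b \<in> box R'" for b
      using ag[of i j] that by (simp add: agree_def q_def shift_apply)
    then have "x a = y (a + q)" "x (a - u) = y (a + q - u)"
      using in_R' by (auto simp: algebra_simps)
    moreover have "y (a + q - u) = y (a + q)" using uv(1) by (metis shift_apply)
    ultimately show ?thesis by simp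
  qed
  then have "shift u x = x" by (auto simp: shift_def)
  then show False using x(2) by blast
qed

text \<open>In a configuration close to \<open>T\<close> the windows of \<open>y\<close> and \<open>z\<close> spread along strips in the
  directions \<open>u\<close> and \<open>v\<close>. Where the strips cross, the window of \<open>z\<close> shows up inside \<open>y\<close>; so
  \<open>z\<close> is a translate of \<open>y\<close> and has both periods.\<close>

lemma isolated_periods_parallel:
  fixes T :: "('a :: finite) config set"
  assumes T: "minimal_not_uniformly_periodic T" and y: "y \<in> T" "z \<in> T"
    and isol: "\<forall>t \<in> T. agree m y t \<longrightarrow> t = y" "\<forall>t \<in> T. agree n z t \<longrightarrow> t = z"
    and uv: "shift u y = y" "shift v z = z"
  shows "det u v = 0"
proof (rule ccontr)
  assume D: "det u v \<noteq> 0"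
  have sub: "subshift T" using T by (simp add: minimal_not_uniformly_periodic_def)
  obtain R1 V1 where V1: "finite V1" "0 \<notin> V1"
    "\<And>x. locally_in R1 x T \<Longrightarrow> (\<forall>v \<in> V1. shift v x \<noteq> x) \<Longrightarrow> \<exists>p. agree m y (shift p x)"
    using minimal_window_recurs[OF T y(1), of m] by blast
  obtain R2 V2 where V2: "finite V2" "0 \<notin> V2"
    "\<And>x. locally_in R2 x T \<Longrightarrow> (\<forall>v \<in> V2. shift v x \<noteq> x) \<Longrightarrow> \<exists>p. agree n z (shift p x)"
    using minimal_window_recurs[OF T y(2), of n] by blast
  obtain k l where k: "u \<in> box k" and l: "v \<in> box l" using ex_in_box by metis
  define R where "R = max (max R1 R2) (m + n + k + l)"
  have "finite (V1 \<union> V2)" "0 \<notin> V1 \<union> V2" using V1 V2 by auto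
  then obtain x where x: "locally_in R x T" "\<forall>w \<in> V1 \<union> V2. shift w x \<noteq> x"
    using T unfolding minimal_not_uniformly_periodic_def uniformly_periodic_def by meson
  have "locally_in R1 x T" "locally_in R2 x T"
    using x(1) by (auto intro: locally_in_mono simp: R_def)
  then obtain p q where p: "agree m y (shift p x)" and q: "agree n z (shift q x)"
    using V1(3) V2(3) x(2) by blast
  obtain i j where ij: "(q - p) + scale i u + scale j v \<in> box (k + l)"
    using lattice_reduction[OF D k l] by blast
  \<comment> \<open>The bounded vector that leads from one of the windows along the strip of \<open>y\<close> to one of the
    windows along the strip of \<open>z\<close>.\<close>
  define w where "w = (q - p) + scale i u + scale j v"
  have "agree R y (shift (p + scale (- i) u) x)"
    using isolated_propagates[OF isol(1) x(1) uv(1) k _ p] by (simp add: R_def)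
  then have "agree n (shift w y) (shift w (shift (p + scale (- i) u) x))"
    by (rule agree_shift[where k = "k + l"]) (use ij in \<open>simp_all add: R_def w_def\<close>)
  also have "shift w (shift (p + scale (- i) u) x) = shift (q + scale j v) x"
    unfolding shift_shift w_def by (rule arg_cong[of _ _ "\<lambda>a. shift a x"]) (simp add: prod_eq_iff)
  finally have yq: "agree n (shift w y) (shift (q + scale j v) x)" .
  have "agree R z (shift (q + scale j v) x)"
    using isolated_propagates[OF isol(2) x(1) uv(2) l _ q] by (simp add: R_def)
  then have "agree n z (shift (q + scale j v) x)"
    by (rule agree_mono) (simp add: R_def)
  then have "agree n z (shift w y)" using yq agree_sym agree_trans by blast
  then have "shift w y = z" using isol(2) subshift_shift[OF sub y(1)] by blast
  then have "shift u z = z" using uv(1) period_shift_iff by metis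
  then show False using isolated_not_doubly_periodic[OF T y(2) isol(2) _ uv(2) D] by blast
qed

lemma parallel_common_multiple:
  assumes "finite V" "0 \<notin> V" "u \<noteq> 0" "\<forall>v \<in> V. det u v = 0"
  shows "\<exists>m \<noteq> 0. \<forall>v \<in> V. \<exists>k. scale m u = scale k v"
  using assms
proof (induction rule: finite_induct)
  case (insert v V)
  then obtain m where m: "m \<noteq> 0" "\<forall>w \<in> V. \<exists>k. scale m u = scale k w" by auto
  have v: "v \<noteq> 0" "fst u * snd v = snd u * fst v" using insert.prems by (auto simp: det_def)
  have "\<exists>n k. n \<noteq> 0 \<and> scale n u = scale k v"
  proof (cases "fst v = 0")
    case True
    then show ?thesis
      using v by (intro exI[of _ "snd v"] exI[of _ "snd u"]) (auto simp: prod_eq_iff algebra_simps)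
  next
    case False
    then show ?thesis
      using v by (intro exI[of _ "fst v"] exI[of _ "fst u"]) (auto simp: prod_eq_iff algebra_simps)
  qed
  then obtain n k where n: "n \<noteq> 0" "scale n u = scale k v" by blast
  have sc: "scale (a * b) w = scale a (scale b w)" for a b w by (simp add: prod_eq_iff)
  have "\<exists>k. scale (m * n) u = scale k w" if w: "w \<in> insert v V" for w
  proof (cases "w = v")
    case True
    then show ?thesis using n(2) by (metis sc)
  next
    case False
    then obtain j where "scale m u = scale j w" using m(2) w by auto
    then have "scale (n * m) u = scale (n * j) w" by (simp add: sc)
    then show ?thesis by (metis mult.commute)
  qed
  then show ?case using m(1) n(1) by (intro exI[of _ "m * n"]) auto
qed (auto intro: exI[of _ 1])

text \<open>If all members of \<open>T\<close> were periodic, finitely many periods would suffice for the isolated ones: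
  otherwise the isolated members outside the orbit of one of them, \<open>y0\<close>, already need infinitely
  many, which makes the smaller subshift without the window of \<open>y0\<close> fail uniform periodicity.
  These periods are parallel, so they have a common multiple, and density transfers it to \<open>T\<close>.\<close>

theorem minimal_contains_aperiodic:
  fixes T :: "('a :: finite) config set"
  assumes T: "minimal_not_uniformly_periodic T" and cnt: "countable T"
  shows "\<exists>c \<in> T. \<not> has_period_direction c"
proof (rule ccontr)
  assume "\<not> ?thesis"
  then have per: "\<And>y. y \<in> T \<Longrightarrow> \<exists>v. v \<noteq> 0 \<and> shift v y = y"
    by (auto simp: has_period_direction_def zero_prod_def)
  have sub: "subshift T" and nup: "\<not> uniformly_periodic T"
    using T by (auto simp: minimal_not_uniformly_periodic_def)
  define isolated where "isolated y \<longleftrightarrow> y \<in> T \<and> (\<exists>n. \<forall>z \<in> T. agree n y z \<longrightarrow> z = y)" for y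
  have dense: "\<exists>z. isolated z \<and> agree n y z" if y: "y \<in> T" for y n
  proof -
    have "{z \<in> T. agree n y z} \<noteq> {}" using y by auto
    then obtain z m where z: "z \<in> T" "agree n y z"
        "\<forall>t \<in> {z \<in> T. agree n y z}. agree m z t \<longrightarrow> t = z"
      using ex_isolated[OF subshift_closed[OF sub] cnt, of "{z \<in> T. agree n y z}"] by blast
    have "t = z" if t: "t \<in> T" "agree (max n m) z t" for t
    proof -
      have "agree n z t" "agree m z t" using t(2) by (auto intro: agree_mono)
      then show ?thesis using z t(1) agree_trans by blast
    qed
    then show ?thesis using z(1,2) unfolding isolated_def by blast
  qed
  have "T \<noteq> {}" using nup uniformly_periodic_empty by metis
  then obtain y0 where y0: "isolated y0" using dense by blast
  then obtain n0 where n0: "y0 \<in> T" "\<forall>z \<in> T. agree n0 y0 z \<longrightarrow> z = y0"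
    unfolding isolated_def by blast
  obtain v0 where v0: "v0 \<noteq> 0" "shift v0 y0 = y0" using per n0(1) by blast
  define bounds where
    "bounds V \<longleftrightarrow> finite V \<and> 0 \<notin> V \<and> (\<forall>y. isolated y \<longrightarrow> (\<exists>v \<in> V. shift v y = y))" for V
  have "\<exists>V. bounds V"
  proof (rule ccontr)
    assume no: "\<nexists>V. bounds V"
    let ?L = "without_window T n0 y0"
    have "uniformly_periodic ?L" using T n0(1) by (rule minimal_without_window)
    then obtain r V where V: "finite V" "0 \<notin> V"
        "\<And>x. locally_in r x ?L \<Longrightarrow> \<exists>v \<in> V. shift v x = x"
      unfolding uniformly_periodic_def by blast
    have "\<not> bounds (insert v0 V)" using no by simp
    then obtain y where y: "isolated y" "\<forall>v \<in> insert v0 V. shift v y \<noteq> y"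
      using V(1,2) v0(1) unfolding bounds_def by auto
    have "shift p y \<noteq> y0" for p
    proof
      assume "shift p y = y0"
      then have "shift v0 y = y" using v0(2) period_shift_iff[of v0 p y] by simp
      then show False using y(2) by simp
    qed
    then have "\<not> agree n0 y0 (shift p y)" for p
      using y(1) n0(2) subshift_shift[OF sub, of y p] unfolding isolated_def by blast
    then have "y \<in> ?L" using y(1) by (simp add: isolated_def without_window_def)
    then have "locally_in r y ?L" by (rule locally_in_self[OF subshift_without_window[OF sub]])
    then show False using V(3) y(2) by blast
  qed
  then obtain V where V: "finite V" "0 \<notin> V" "\<And>y. isolated y \<Longrightarrow> \<exists>v \<in> V. shift v y = y"
    unfolding bounds_def by blast
  define W where "W = {v \<in> V. \<exists>y. isolated y \<and> shift v y = y}"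
  have "\<forall>v \<in> W. det v0 v = 0"
    using isolated_periods_parallel[OF T n0(1) _ n0(2) _ v0(2)] unfolding W_def isolated_def by blast
  moreover have "finite W" "0 \<notin> W" using V by (auto simp: W_def)
  ultimately obtain m where m: "m \<noteq> 0" "\<forall>v \<in> W. \<exists>k. scale m v0 = scale k v"
    using parallel_common_multiple[of W v0] v0(1) by blast
  define u where "u = scale m v0"
  have u0: "u \<noteq> 0" using m(1) v0(1) by (simp add: u_def scale_eq_0)
  have isol_u: "shift u y = y" if y: "isolated y" for y
  proof -
    obtain v where v: "v \<in> V" "shift v y = y" using V(3) y by blast
    then have "v \<in> W" using y unfolding W_def by blast
    then obtain k where "u = scale k v" using m(2) u_def by blast
    then show ?thesis using period_scale[OF v(2)] by simp
  qed
  obtain k where k: "u \<in> box k" using ex_in_box by blast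
  have T_u: "y (- u) = y 0" if y: "y \<in> T" for y
  proof -
    obtain z where z: "isolated z" "agree k y z" using dense[OF y] by blast
    have "z (0 - u) = z 0" using isol_u[OF z(1)] by (metis shift_apply)
    moreover have "0 \<in> box k" "- u \<in> box k" using k by (simp_all, simp add: in_box)
    ultimately show ?thesis using z(2) by (simp add: agree_def)
  qed
  have "shift u x = x" if x: "locally_in k x T" for x
  proof
    fix a
    obtain y where y: "y \<in> T" "agree k (shift (- a) x) y" using x unfolding locally_in_def by blast
    moreover have "0 \<in> box k" "- u \<in> box k" using k by (simp_all, simp add: in_box)
    ultimately have "shift (- a) x 0 = y 0" "shift (- a) x (- u) = y (- u)"
      by (simp_all only: agree_def)
    then show "shift u x a = x a" using T_u[OF y(1)] by (simp add: shift_apply)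
  qed
  then have "uniformly_periodic T"
    unfolding uniformly_periodic_def using u0
    by (intro exI[of _ k] exI[of _ "{u}"]) simp
  then show False using nup by contradiction
qed

section \<open>The order on configurations\<close>

text \<open>Equivalently, \<open>x\<close> lies in the closure of the orbit of \<open>y\<close>. This is the form in which the
  order is used from here on.\<close>

lemma pat_le_iff: "x \<preceq> y \<longleftrightarrow> (\<forall>n. \<exists>p. agree n x (shift p y))"
proof
  assume le: "x \<preceq> y"
  show "\<forall>n. \<exists>p. agree n x (shift p y)"
  proof
    fix n
    define P where "P = (\<lambda>a. if a \<in> box n then Some (x a) else None)"
    have dom: "dom P = box n" by (auto simp: P_def split: if_splits)
    have "appears_in P x" unfolding appears_in_def dom by (rule exI[of _ 0]) (simp add: P_def)
    then have "appears_in P y" using le dom by (simp add: pat_le_def is_pattern_def)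
    then obtain v where "\<forall>a \<in> box n. P a = Some (y (a + v))" unfolding appears_in_def dom by blast
    then have "agree n x (shift (- v) y)" by (simp add: agree_def P_def shift_apply)
    then show "\<exists>p. agree n x (shift p y)" ..
  qed
next
  assume ag: "\<forall>n. \<exists>p. agree n x (shift p y)"
  show "x \<preceq> y"
    unfolding pat_le_def
  proof (intro allI impI)
    fix P assume P: "is_pattern P" "appears_in P x"
    then obtain v where v: "\<forall>a \<in> dom P. P a = Some (x (a + v))" unfolding appears_in_def by blast
    have "finite ((\<lambda>a. a + v) ` dom P)" using P(1) by (simp add: is_pattern_def)
    then obtain n where n: "(\<lambda>a. a + v) ` dom P \<subseteq> box n" using finite_subset_box by blast
    obtain p where p: "agree n x (shift p y)" using ag by blast
    have "P a = Some (y (a + (v - p)))" if "a \<in> dom P" for a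
    proof -
      have "a + v \<in> box n" using n that by blast
      then have "x (a + v) = y (a + v - p)" using p by (simp add: agree_def shift_apply)
      then show ?thesis using v that by (simp add: algebra_simps)
    qed
    then show "appears_in P y" unfolding appears_in_def by blast
  qed
qed

lemma pat_le_refl [simp]: "x \<preceq> x"
  by (simp add: pat_le_def)

lemma pat_le_trans: "x \<preceq> y \<Longrightarrow> y \<preceq> z \<Longrightarrow> x \<preceq> z"
  by (simp add: pat_le_def)

lemma pat_less_iff: "x \<prec> y \<longleftrightarrow> x \<preceq> y \<and> \<not> y \<preceq> x"
  by (auto simp: pat_less_def pat_equiv_def)

lemma shift_pat_le: "shift p x \<preceq> x"
  unfolding pat_le_iff using agree_refl by blast

lemma pat_le_shift: "x \<preceq> shift p x"
  using shift_pat_le[of "- p" "shift p x"] by simp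

lemma pat_le_in_subshift:
  assumes "subshift X" "y \<in> X" "x \<preceq> y"
  shows "x \<in> X"
  using subshift_closed[OF assms(1)]
proof (rule closedD)
  fix n
  obtain p where "agree n x (shift p y)" using assms(3) unfolding pat_le_iff by blast
  then show "\<exists>z \<in> X. agree n x z" using subshift_shift[OF assms(1,2)] by blast
qed

lemma subshift_below: "subshift {y. y \<preceq> x}"
  unfolding subshift_def
proof
  show "closed_under_limits {y. y \<preceq> x}"
    unfolding closed_under_limits_def
  proof (intro allI impI CollectI)
    fix y assume *: "\<forall>n. \<exists>z \<in> {y. y \<preceq> x}. agree n y z"
    show "y \<preceq> x"
      unfolding pat_le_iff
    proof
      fix n
      obtain z where z: "z \<preceq> x" "agree n y z" using * by blast
      then obtain p where "agree n z (shift p x)" unfolding pat_le_iff by blast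
      then show "\<exists>p. agree n y (shift p x)" using z(2) agree_trans by blast
    qed
  qed
  show "\<forall>y \<in> {y. y \<preceq> x}. \<forall>p. shift p y \<in> {y. y \<preceq> x}"
    using shift_pat_le pat_le_trans by blast
qed

lemma has_period_direction_iff: "has_period_direction x \<longleftrightarrow> (\<exists>v. v \<noteq> 0 \<and> shift v x = x)"
  by (simp add: has_period_direction_def zero_prod_def)

text \<open>A subshift with an aperiodic member is not uniformly periodic. So the orbit closure of an aperiodic
  \<open>y \<preceq> c\<close> is all of the minimal subshift, which contains \<open>c\<close>; hence \<open>c \<preceq> y\<close>.\<close>

theorem ex_minimal_aperiodic:
  fixes X :: "('a :: finite) config set"
  assumes X: "subshift X" "countable X" and ap: "\<exists>x \<in> X. \<not> has_period_direction x"
  shows "\<exists>c \<in> X. \<not> has_period_direction c \<and> (\<forall>y. y \<prec> c \<longrightarrow> has_period_direction y)"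
proof -
  have aperiodic_nup: "\<not> uniformly_periodic Y"
    if x: "subshift Y" "x \<in> Y" "\<not> has_period_direction x" for Y and x :: "'a config"
  proof
    assume "uniformly_periodic Y"
    then obtain r V where V: "0 \<notin> V" "\<And>x. locally_in r x Y \<Longrightarrow> \<exists>v \<in> V. shift v x = x"
      unfolding uniformly_periodic_def by blast
    then obtain v where "v \<in> V" "shift v x = x" using locally_in_self[OF x(1,2)] by blast
    then show False using V(1) x(3) unfolding has_period_direction_iff by metis
  qed
  obtain T where T: "T \<subseteq> X" "minimal_not_uniformly_periodic T"
    using ex_minimal_not_uniformly_periodic[OF X] aperiodic_nup[OF X(1)] ap by blast
  then obtain c where c: "c \<in> T" "\<not> has_period_direction c"
    using minimal_contains_aperiodic countable_subset[OF T(1) X(2)] by blast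
  have sub: "subshift T" using T(2) by (simp add: minimal_not_uniformly_periodic_def)
  have "has_period_direction y" if y: "y \<prec> c" for y
  proof (rule ccontr)
    assume ny: "\<not> has_period_direction y"
    have "\<not> uniformly_periodic {z. z \<preceq> y}"
      using aperiodic_nup[OF subshift_below _ ny] by simp
    moreover have "{z. z \<preceq> y} \<subseteq> T"
      using y pat_le_in_subshift[OF sub c(1)] pat_le_trans by (auto simp: pat_less_iff)
    ultimately have "{z. z \<preceq> y} = T"
      using T(2) subshift_below[of y] unfolding minimal_not_uniformly_periodic_def by blast
    then show False using c(1) y by (auto simp: pat_less_iff)
  qed
  then show ?thesis using T(1) c by blast
qed

section \<open>Singly and doubly periodic configurations\<close>

definition doubly_periodic :: "'a config \<Rightarrow> bool" where
  "doubly_periodic x \<longleftrightarrow> (\<exists>u v. det u v \<noteq> 0 \<and> shift u x = x \<and> shift v x = x)"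

text \<open>A limit of translates from a finite supply is one of them.\<close>

lemma agree_all_shift_of_finite:
  assumes K: "finite K" and ag: "\<And>n. \<exists>q \<in> K. agree n z (shift q y)"
  shows "\<exists>q \<in> K. z = shift q y"
proof (rule ccontr)
  assume "\<not> ?thesis"
  then have "\<forall>q \<in> K. \<exists>n. \<not> agree n z (shift q y)" using agree_all_eq by metis
  then obtain f where f: "\<forall>q \<in> K. \<not> agree (f q) z (shift q y)" by metis
  obtain q where q: "q \<in> K" "agree (Max (f ` K)) z (shift q y)" using ag by blast
  then have "agree (f q) z (shift q y)" using K by (intro agree_mono[OF q(2)] Max_ge) auto
  then show False using f q(1) by blast
qed

text \<open>A doubly periodic configuration has finitely many translates, so its orbit is closed.\<close>

lemma below_doubly_periodic:
  assumes y: "doubly_periodic y" and zy: "z \<preceq> y"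
  shows "y \<preceq> z"
proof -
  obtain u v where uv: "det u v \<noteq> 0" "shift u y = y" "shift v y = y"
    using y unfolding doubly_periodic_def by blast
  obtain k l where kl: "u \<in> box k" "v \<in> box l" using ex_in_box by metis
  have "\<exists>q \<in> box (k + l). agree n z (shift q y)" for n
  proof -
    obtain p where p: "agree n z (shift p y)" using zy unfolding pat_le_iff by blast
    obtain i j where ij: "p + scale i u + scale j v \<in> box (k + l)"
      using lattice_reduction[OF uv(1) kl] by blast
    have "shift (p + scale i u + scale j v) y = shift (p + scale i u) (shift (scale j v) y)"
      by simp
    also have "\<dots> = shift p (shift (scale i u) y)" using period_scale[OF uv(3)] by simp
    also have "\<dots> = shift p y" using period_scale[OF uv(2)] by simp
    finally show ?thesis using p ij by metis
  qed
  then obtain q where "z = shift q y" using agree_all_shift_of_finite[OF finite_box] by blast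
  then show ?thesis using pat_le_shift by simp
qed

text \<open>A bounded strip along \<open>v\<close> is finite modulo \<open>v\<close>.\<close>

lemma strip_reduction:
  assumes "v \<noteq> 0"
  shows "\<exists>K. \<forall>a. \<bar>det v a\<bar> \<le> int B \<longrightarrow> (\<exists>k. a + scale k v \<in> box K)"
proof -
  define w where "w = (- snd v, fst v)"
  have D: "det v w \<noteq> 0"
  proof -
    have "det v w = (fst v)\<^sup>2 + (snd v)\<^sup>2" by (simp add: det_def w_def power2_eq_square)
    then show ?thesis using assms by (simp add: prod_eq_iff sum_power2_eq_zero_iff)
  qed
  obtain k l where kl: "v \<in> box k" "w \<in> box l" using ex_in_box by metis
  define K where "K = k + l + B * l + (k + l) * (k + k) * l"
  have "\<exists>i. a + scale i v \<in> box K" if a: "\<bar>det v a\<bar> \<le> int B" for a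
  proof -
    obtain i j where b: "a + scale i v + scale j w \<in> box (k + l)" (is "?b \<in> _")
      using lattice_reduction[OF D kl] by blast
    \<comment> \<open>Both \<open>a\<close> and its reduction have bounded distance to the line along \<open>v\<close>, which bounds \<open>j\<close>; so
      the multiple of \<open>w\<close> can be taken back.\<close>
    have "det v ?b = det v a + j * det v w" by (simp add: det_add det_scale)
    moreover have "\<bar>det v ?b\<bar> \<le> int ((k + l) * (k + k))"
    proof -
      have "\<bar>det v ?b\<bar> \<le> \<bar>fst v\<bar> * \<bar>snd ?b\<bar> + \<bar>snd v\<bar> * \<bar>fst ?b\<bar>"
        unfolding det_def by (metis abs_mult abs_triangle_ineq4)
      also have "\<dots> \<le> int k * int (k + l) + int k * int (k + l)"
        using b kl(1) by (intro add_mono mult_mono) (auto simp: in_box)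
      finally show ?thesis by (simp add: algebra_simps)
    qed
    ultimately have "\<bar>j * det v w\<bar> \<le> int (B + (k + l) * (k + k))" using a by linarith
    moreover have "\<bar>j\<bar> * 1 \<le> \<bar>j\<bar> * \<bar>det v w\<bar>" using D by (intro mult_left_mono) auto
    ultimately have j: "\<bar>j\<bar> \<le> int (B + (k + l) * (k + k))" by (simp add: abs_mult)
    have "scale j w \<in> box ((B + (k + l) * (k + k)) * l)"
      using j kl(2) by (auto simp: in_box abs_mult intro!: mult_mono)
    then have "?b - scale j w \<in> box (k + l + (B + (k + l) * (k + k)) * l)"
      using b box_diff by blast
    moreover have "?b - scale j w = a + scale i v" by simp
    moreover have "k + l + (B + (k + l) * (k + k)) * l = K" by (simp add: K_def algebra_simps)
    ultimately show ?thesis by metis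
  qed
  then show ?thesis by blast
qed

section \<open>Periodic configurations of a countable subshift of finite type\<close>

text \<open>With \<open>M\<close> such that \<open>box M\<close> contains the supports of all forbidden patterns, membership in \<open>X\<close>
  is decided by the windows of radius \<open>M\<close>. This allows configurations of \<open>X\<close> to be glued along
  overlaps of that width.\<close>

lemma sft_locally_determined:
  assumes "subshift_of_finite_type X"
  shows "subshift X" "\<exists>M. \<forall>z. locally_in M z X \<longrightarrow> z \<in> X"
proof -
  obtain F where F: "finite F" "\<forall>P \<in> F. is_pattern P" "X = avoiding F"
    using assms unfolding subshift_of_finite_type_def by blast
  have "finite (\<Union>P \<in> F. dom P)" using F by (auto simp: is_pattern_def)
  then obtain M where M: "(\<Union>P \<in> F. dom P) \<subseteq> box M" using finite_subset_box by blast
  have loc: "z \<in> X" if z: "locally_in M z X" for z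
  proof (rule ccontr)
    assume "z \<notin> X"
    then obtain P where P: "P \<in> F" "appears_in P z" using F(3) by (auto simp: avoiding_def)
    then obtain v where v: "\<forall>a \<in> dom P. P a = Some (z (a + v))" unfolding appears_in_def by blast
    obtain y where y: "y \<in> X" "agree M (shift (- v) z) y" using z unfolding locally_in_def by blast
    have "P a = Some (y (a + 0))" if a: "a \<in> dom P" for a
    proof -
      have "a \<in> box M" using M P(1) a by blast
      then have "z (a + v) = y a" using y(2) by (simp add: agree_def shift_apply)
      then show ?thesis using v a by simp
    qed
    then have "appears_in P y" unfolding appears_in_def by blast
    then show False using y(1) P(1) F(3) by (auto simp: avoiding_def)
  qed
  have inv: "shift p x \<in> X" if x: "x \<in> X" for p x
  proof -
    have "appears_in P x" if "appears_in P (shift p x)" for P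
      using that unfolding appears_in_def shift_apply
      by (metis add_diff_eq)
    then show ?thesis using x F(3) by (auto simp: avoiding_def)
  qed
  show "subshift X"
    unfolding subshift_def
  proof
    show "closed_under_limits X"
      unfolding closed_under_limits_def
    proof (intro allI impI)
      fix y assume *: "\<forall>n. \<exists>z \<in> X. agree n y z"
      have "locally_in M y X"
        unfolding locally_in_def
      proof
        fix p
        obtain k where k: "p \<in> box k" using ex_in_box by blast
        obtain z where z: "z \<in> X" "agree (M + k) y z" using * by blast
        have "agree M (shift p y) (shift p z)" using agree_shift[OF z(2) k] by simp
        then show "\<exists>z \<in> X. agree M (shift p y) z" using inv[OF z(1)] by blast
      qed
      then show "y \<in> X" by (rule loc)
    qed
  qed (use inv in blast)
  show "\<exists>M. \<forall>z. locally_in M z X \<longrightarrow> z \<in> X" using loc by blast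
qed

lemma le_mult_pos: "0 \<le> m \<Longrightarrow> 0 < D \<Longrightarrow> m \<le> m * (D :: int)"
  using mult_left_mono[of 1 D m] by simp

lemma det_box_bound:
  assumes "a \<in> box n"
  shows "\<bar>det v a\<bar> \<le> int n * (\<bar>fst v\<bar> + \<bar>snd v\<bar>)"
proof -
  have "\<bar>det v a\<bar> \<le> \<bar>fst v\<bar> * \<bar>snd a\<bar> + \<bar>snd v\<bar> * \<bar>fst a\<bar>"
    unfolding det_def by (metis abs_mult abs_triangle_ineq4)
  also have "\<dots> \<le> \<bar>fst v\<bar> * int n + \<bar>snd v\<bar> * int n"
    using assms by (intro add_mono mult_left_mono) (auto simp: in_box)
  finally show ?thesis by (simp add: algebra_simps)
qed

text \<open>Consider all members of \<open>X\<close> that far out on the positive side coincide with a translate of \<open>y\<close>.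
  One of them, \<open>x\<close>, is isolated. Beyond any window, \<open>x\<close> contains an occurrence of the recurrent
  strip, where \<open>y\<close> may be resumed from a later occurrence \<open>p'\<close> instead of \<open>p\<close>: the strip is
  wide enough for gluing. Isolation forces both continuations to be equal, and then \<open>p' - p\<close> is
  a period of \<open>y\<close> from \<open>p\<close> on.\<close>

lemma recurrent_strip_eventually_periodic:
  assumes X: "subshift X" "countable X" and loc: "\<And>z. locally_in M z X \<Longrightarrow> z \<in> X" and y: "y \<in> X"
    and W: "2 * int M * (\<bar>fst v\<bar> + \<bar>snd v\<bar>) < W"
    and P: "\<And>B. \<exists>p \<in> P. B < det v p"
    and strip: "\<And>p q b. p \<in> P \<Longrightarrow> q \<in> P \<Longrightarrow> 0 \<le> det v b \<Longrightarrow> det v b < W \<Longrightarrow> y (b + p) = y (b + q)"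
  shows "\<exists>d s. 0 < det v d \<and> (\<forall>a. s \<le> det v a \<longrightarrow> y (a + d) = y a)"
proof -
  define A where "A = {x \<in> X. \<exists>q s. \<forall>a. s \<le> det v a \<longrightarrow> x a = y (a + q)}"
  have "\<forall>a. 0 \<le> det v a \<longrightarrow> y a = y (a + 0)" by simp
  then have "y \<in> A" using y unfolding A_def by blast
  moreover have "A \<subseteq> X" by (auto simp: A_def)
  ultimately obtain x n where x: "x \<in> A" and isol: "\<forall>z \<in> A. agree n x z \<longrightarrow> z = x"
    using ex_isolated[OF subshift_closed[OF X(1)] X(2), of A] by blast
  obtain q s where qs: "\<And>a. s \<le> det v a \<Longrightarrow> x a = y (a + q)" and xX: "x \<in> X"
    using x unfolding A_def by blast
  define N where "N = \<bar>fst v\<bar> + \<bar>snd v\<bar>"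
  obtain p where p: "p \<in> P" "det v q + max s (int n * N) < det v p" using P by blast
  obtain p' where p': "p' \<in> P" "det v p < det v p'" using P by blast
  define t where "t = det v p - det v q"
  have "0 \<le> 2 * int M * (\<bar>fst v\<bar> + \<bar>snd v\<bar>)" by simp
  then have W0: "0 < W" using W by linarith
  define x' where "x' = (\<lambda>a. if det v a < t + W then x a else y (a + (q + p' - p)))"
  have x'y: "x' a = y (a + (q + p' - p))" if a: "t \<le> det v a" for a
  proof (cases "det v a < t + W")
    case True
    have "0 \<le> det v (a + q - p)" "det v (a + q - p) < W"
      using a True by (simp_all add: det_add det_diff t_def)
    then have "y (a + q - p + p') = y (a + q - p + p)" using strip[OF p'(1) p(1)] by blast
    moreover have "x a = y (a + q)" using qs a p(2) by (simp add: t_def)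
    ultimately show ?thesis using True by (simp add: x'_def algebra_simps)
  qed (simp add: x'_def)
  have "locally_in M x' X"
    unfolding locally_in_def
  proof
    fix r
    show "\<exists>z \<in> X. agree M (shift r x') z"
    proof (cases "\<exists>a \<in> box M. t + W \<le> det v (a - r)")
      case True
      then obtain a0 where a0: "a0 \<in> box M" "t + W \<le> det v (a0 - r)" by blast
      have "t \<le> det v (a - r)" if a: "a \<in> box M" for a
        using det_box_bound[OF a0(1), of v] det_box_bound[OF a, of v] W a0(2)
        by (simp add: det_diff algebra_simps)
      then have "agree M (shift r x') (shift r (shift (- (q + p' - p)) y))"
        unfolding agree_def by (auto simp: shift_apply x'y algebra_simps)
      then show ?thesis using subshift_shift[OF X(1)] y by blast
    next
      case False
      then have "agree M (shift r x') (shift r x)"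
        unfolding agree_def by (auto simp: shift_apply x'_def)
      then show ?thesis using subshift_shift[OF X(1) xX] by blast
    qed
  qed
  then have "x' \<in> A" using loc x'y unfolding A_def by blast
  moreover have "agree n x x'"
    unfolding agree_def
  proof
    fix a assume "a \<in> box n"
    then have "det v a < t + W"
      using det_box_bound[of a n v] p(2) W0 by (simp add: t_def N_def)
    then show "x a = x' a" by (simp add: x'_def)
  qed
  ultimately have "x' = x" using isol by blast
  have "y (a + (p' - p)) = y a" if a: "det v p \<le> det v a" for a
  proof -
    have "t \<le> det v (a - q)" using a by (simp add: t_def det_diff)
    then have "x (a - q) = y (a - q + (q + p' - p))" "x (a - q) = y (a - q + q)"
      using x'y[of "a - q"] \<open>x' = x\<close> qs[of "a - q"] p(2) by (simp_all add: t_def)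
    then show ?thesis by (simp add: algebra_simps)
  qed
  moreover have "0 < det v (p' - p)" using p'(2) by (simp add: det_diff)
  ultimately show ?thesis by blast
qed

text \<open>Modulo \<open>v\<close> a strip carries finitely many patterns, so among its translates by multiples of the
  vector \<open>e\<close> orthogonal to \<open>v\<close> some pattern occurs infinitely often.\<close>

lemma periodic_eventually_periodic:
  fixes X :: "('a :: finite) config set"
  assumes X: "subshift X" "countable X" and loc: "\<And>z. locally_in M z X \<Longrightarrow> z \<in> X" and y: "y \<in> X"
    and v: "v \<noteq> 0" "shift v y = y"
  shows "\<exists>d s. 0 < det v d \<and> (\<forall>a. s \<le> det v a \<longrightarrow> y (a + d) = y a)"
proof -
  define W where "W = 2 * M * nat (\<bar>fst v\<bar> + \<bar>snd v\<bar>) + 1"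
  define e where "e = (- snd v, fst v)"
  have "det v e = (fst v)\<^sup>2 + (snd v)\<^sup>2" by (simp add: det_def e_def power2_eq_square)
  then have e: "0 < det v e"
    using v(1) by (simp add: prod_eq_iff sum_power2_gt_zero_iff)
  obtain K where K: "\<forall>a. \<bar>det v a\<bar> \<le> int W \<longrightarrow> (\<exists>k. a + scale k v \<in> box K)"
    using strip_reduction[OF v(1)] by blast
  define g where "g i = scale (int i) e" for i
  obtain J where J: "infinite J"
      "\<forall>i \<in> J. \<forall>j \<in> J. agree K (shift (- g i) y) (shift (- g j) y)"
    using infinite_agreeing_subset[of UNIV K "\<lambda>i. shift (- g i) y"] by auto
  show ?thesis
  proof (rule recurrent_strip_eventually_periodic[OF X loc y, where v = v and W = "int W" and P = "g ` J"])
    show "2 * int M * (\<bar>fst v\<bar> + \<bar>snd v\<bar>) < int W" by (simp add: W_def)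
    show "\<exists>p \<in> g ` J. B < det v p" for B
    proof -
      obtain i where i: "i \<in> J" "nat B < i"
        using J(1) by (meson infinite_nat_iff_unbounded)
      have "B < int i" using i(2) by simp
      also have "int i \<le> det v (g i)" using e le_mult_pos by (simp add: g_def det_scale)
      finally have "B < det v (g i)" .
      then show ?thesis using i(1) by blast
    qed
    show "y (b + p) = y (b + q)"
      if pq: "p \<in> g ` J" "q \<in> g ` J" and b: "0 \<le> det v b" "det v b < int W" for p q b
    proof -
      obtain k where k: "b + scale k v \<in> box K" using K b by fastforce
      have "agree K (shift (- p) y) (shift (- q) y)" using J(2) pq by auto
      then have "y (b + scale k v + p) = y (b + scale k v + q)"
        using k by (simp add: agree_def shift_apply)
      moreover have "y (c + scale k v) = y c" for c
        using period_scale[OF v(2), of k] unfolding period_iff by blast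
      ultimately show ?thesis by (metis add.commute add.left_commute)
    qed
  qed
qed

lemma period_below:
  assumes v: "shift v y = y" and zy: "z \<preceq> y"
  shows "shift v z = z"
proof
  fix a
  obtain n where n: "{a, a - v} \<subseteq> box n" using finite_subset_box[of "{a, a - v}"] by blast
  obtain p where "agree n z (shift p y)" using zy unfolding pat_le_iff by blast
  moreover have "shift v (shift p y) = shift p y" using v period_shift_iff by metis
  ultimately show "shift v z a = z a"
    using n unfolding agree_def by (metis insert_subset shift_apply)
qed

text \<open>A limit of windows of \<open>y\<close> moving off to the side on which \<open>y\<close> has period \<open>d\<close> has this period
  everywhere. (The window seen by \<open>shift p y\<close> at the origin is that of \<open>y\<close> around \<open>- p\<close>, whence
  the sign of \<open>det v p\<close>.)\<close>

lemma far_limit_periodic: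
  assumes d: "\<forall>a. s \<le> det v a \<longrightarrow> y (a + d) = y a"
    and far: "\<And>N. \<exists>p. agree N z (shift p y) \<and> det v p < - int N"
  shows "shift d z = z"
  unfolding period_iff
proof
  fix a
  obtain n where n: "{a, a + d} \<subseteq> box n" using finite_subset_box[of "{a, a + d}"] by blast
  define N where "N = max n (nat (s - det v a))"
  obtain p where p: "agree N z (shift p y)" "det v p < - int N" using far by blast
  have "a \<in> box N" "a + d \<in> box N" using n box_mono[of n N] by (auto simp: N_def)
  then have "z (a + d) = y (a + d - p)" "z a = y (a - p)" using p(1) by (auto simp: agree_def shift_apply)
  moreover have "s \<le> det v (a - p)" using p(2) by (auto simp: det_diff N_def)
  then have "y (a - p + d) = y (a - p)" using d by blast
  ultimately show "z (a + d) = z a" by (simp add: algebra_simps)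
qed

text \<open>Modulo \<open>v\<close>, the windows of \<open>y\<close> approximating \<open>z\<close> either stay in a bounded region, and then \<open>z\<close>
  is a translate of \<open>y\<close>, or they move off to one of the two sides, and then \<open>z\<close> inherits a second
  period. The left side is the right side for the period \<open>- v\<close>.\<close>

lemma below_periodic:
  fixes X :: "('a :: finite) config set"
  assumes X: "subshift X" "countable X" and loc: "\<And>z. locally_in M z X \<Longrightarrow> z \<in> X" and y: "y \<in> X"
    and v: "v \<noteq> 0" "shift v y = y" and zy: "z \<preceq> y"
  shows "(\<exists>p. z = shift p y) \<or> doubly_periodic z"
proof -
  have vz: "shift v z = z" using period_below[OF v(2) zy] .
  have one_side: "doubly_periodic z"
    if u: "u \<noteq> 0" "shift u y = y" "shift u z = z"
      and far: "\<And>N. \<exists>p. agree N z (shift p y) \<and> det u p < - int N" for u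
  proof -
    obtain d s where d: "0 < det u d" "\<forall>a. s \<le> det u a \<longrightarrow> y (a + d) = y a"
      using periodic_eventually_periodic[OF X loc y u(1,2)] by blast
    have "shift d z = z" using far_limit_periodic[OF d(2) far] .
    moreover have "det u d \<noteq> 0" using d(1) by simp
    ultimately show ?thesis using u(3) unfolding doubly_periodic_def by blast
  qed
  consider (right) "\<And>N. \<exists>p. agree N z (shift p y) \<and> det v p < - int N"
    | (left) "\<And>N. \<exists>p. agree N z (shift p y) \<and> det (- v) p < - int N"
    | (mid) N1 N2 where "\<And>p. agree N1 z (shift p y) \<Longrightarrow> - int N1 \<le> det v p"
        "\<And>p. agree N2 z (shift p y) \<Longrightarrow> - int N2 \<le> det (- v) p"
    by (meson linorder_not_le)
  then show ?thesis
  proof cases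
    case right
    then show ?thesis using one_side[OF v vz] by blast
  next
    case left
    have "- v \<noteq> 0" using v(1) by simp
    then show ?thesis
      using one_side[OF _ shift_uminus_period[OF v(2)] shift_uminus_period[OF vz]] left by blast
  next
    case mid
    define N where "N = max N1 N2"
    obtain K where K: "\<forall>a. \<bar>det v a\<bar> \<le> int N \<longrightarrow> (\<exists>k. a + scale k v \<in> box K)"
      using strip_reduction[OF v(1)] by blast
    have "\<exists>q \<in> box K. agree n z (shift q y)" for n
    proof -
      obtain p where p: "agree (max n N) z (shift p y)" using zy unfolding pat_le_iff by blast
      have "agree N1 z (shift p y)" "agree N2 z (shift p y)" "agree n z (shift p y)"
        using p by (auto intro: agree_mono simp: N_def)
      then have "\<bar>det v p\<bar> \<le> int N" and pn: "agree n z (shift p y)"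
        using mid(1)[of p] mid(2)[of p] by (auto simp: det_uminus N_def)
      then obtain k where k: "p + scale k v \<in> box K" using K by blast
      have "shift (p + scale k v) y = shift p (shift (scale k v) y)" by simp
      then have "shift (p + scale k v) y = shift p y" using period_scale[OF v(2)] by simp
      then show ?thesis using k pn by metis
    qed
    then show ?thesis using agree_all_shift_of_finite[OF finite_box] by blast
  qed
qed

lemma periodic_no_chain:
  fixes X :: "('a :: finite) config set"
  assumes X: "subshift X" "countable X" and loc: "\<And>z. locally_in M z X \<Longrightarrow> z \<in> X" and y: "y \<in> X"
    and per: "has_period_direction y" and zy: "z \<prec> y" and wz: "w \<prec> z"
  shows False
proof -
  obtain v where v: "v \<noteq> 0" "shift v y = y" using per unfolding has_period_direction_iff by blast
  consider p where "z = shift p y" | "doubly_periodic z"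
    using below_periodic[OF X loc y v] zy unfolding pat_less_iff by blast
  then show False
  proof cases
    case 1
    then show False using zy pat_le_shift[of y p] by (simp add: pat_less_iff)
  next
    case 2
    then show False using wz below_doubly_periodic by (auto simp: pat_less_iff)
  qed
qed

text \<open>Translating \<open>y\<close> by multiples of the eventual period \<open>d\<close> gives in the limit a doubly periodic
  configuration, which cannot be equivalent to \<open>y\<close>, because equivalent configurations have the same
  periods.\<close>

lemma singly_periodic_not_minimal:
  fixes X :: "('a :: finite) config set"
  assumes X: "subshift X" "countable X" and loc: "\<And>z. locally_in M z X \<Longrightarrow> z \<in> X" and y: "y \<in> X"
    and per: "has_period_direction y" and single: "\<not> doubly_periodic y"
  shows "\<exists>z. z \<prec> y"
proof -
  obtain v where v: "v \<noteq> 0" "shift v y = y" using per unfolding has_period_direction_iff by blast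
  obtain d s where d: "0 < det v d" "\<forall>a. s \<le> det v a \<longrightarrow> y (a + d) = y a"
    using periodic_eventually_periodic[OF X loc y v] by blast
  obtain z where z: "\<And>n. \<exists>m \<ge> n. agree n z (shift (scale (- int m) d) y)"
    using compactness[of "\<lambda>m. shift (scale (- int m) d) y"] by blast
  have zy: "z \<preceq> y" unfolding pat_le_iff using z by blast
  have "\<exists>p. agree N z (shift p y) \<and> det v p < - int N" for N
  proof -
    obtain m where m: "Suc N \<le> m" "agree (Suc N) z (shift (scale (- int m) d) y)" using z by blast
    have "int m \<le> int m * det v d" using d(1) le_mult_pos by simp
    then have "int N < int m * det v d" using m(1) by linarith
    then have "det v (scale (- int m) d) < - int N" by (simp add: det_scale)
    moreover have "agree N z (shift (scale (- int m) d) y)" using m(2) by (rule agree_mono) simp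
    ultimately show ?thesis by blast
  qed
  then have "shift d z = z" using far_limit_periodic[OF d(2)] by blast
  then have dz: "doubly_periodic z"
    using period_below[OF v(2) zy] d(1) unfolding doubly_periodic_def by (metis less_irrefl)
  have "\<not> y \<preceq> z"
  proof
    assume "y \<preceq> z"
    have "shift u y = y" if "shift u z = z" for u using period_below[OF that \<open>y \<preceq> z\<close>] .
    then show False using dz single unfolding doubly_periodic_def by blast
  qed
  then show ?thesis using zy by (auto simp: pat_less_iff)
qed

section \<open>Below an aperiodic configuration\<close>

text \<open>The orbit of \<open>c\<close> is dense in its closure, so an isolated member of the closure is a translate
  of \<open>c\<close>.\<close>

lemma isolated_in_own_closure:
  assumes X: "subshift X" "countable X" and c: "c \<in> X"
  shows "\<exists>n. \<forall>y. y \<preceq> c \<longrightarrow> agree n c y \<longrightarrow> y = c"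
proof -
  have "{y. y \<preceq> c} \<subseteq> X" using pat_le_in_subshift[OF X(1) c] by blast
  moreover have "c \<in> {y. y \<preceq> c}" by simp
  ultimately obtain x n where x: "x \<preceq> c" and isol: "\<forall>y. y \<preceq> c \<longrightarrow> agree n x y \<longrightarrow> y = x"
    using ex_isolated[OF subshift_closed[OF X(1)] X(2), of "{y. y \<preceq> c}"] by blast
  obtain p where "agree n x (shift p c)" using x unfolding pat_le_iff by blast
  then have p: "shift p c = x" using isol shift_pat_le by blast
  obtain k where k: "p \<in> box k" using ex_in_box by blast
  have "y = c" if y: "y \<preceq> c" "agree (n + k) c y" for y
  proof -
    have "agree n x (shift p y)" using agree_shift[OF y(2) k] p by simp
    moreover have "shift p y \<preceq> c" using shift_pat_le y(1) pat_le_trans by blast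
    ultimately have "shift p y = shift p c" using isol p by blast
    then show ?thesis by simp
  qed
  then show ?thesis by blast
qed

text \<open>If \<open>c \<preceq> y\<close>, then \<open>y\<close> contains the window that isolates \<open>c\<close>, and so do translates of \<open>c\<close>
  arbitrarily far away; but an aperiodic \<open>c\<close> contains its isolating window only once.\<close>

lemma limit_at_infinity_below:
  assumes X: "subshift X" "countable X" and c: "c \<in> X" "\<not> has_period_direction c"
    and far: "\<And>n. \<exists>p. p \<notin> box n \<and> agree n y (shift p c)"
  shows "y \<prec> c"
proof -
  obtain n where n: "\<And>z. z \<preceq> c \<Longrightarrow> agree n c z \<Longrightarrow> z = c"
    using isolated_in_own_closure[OF X c(1)] by blast
  have yc: "y \<preceq> c" unfolding pat_le_iff using far by blast
  moreover have "\<not> c \<preceq> y"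
  proof
    assume "c \<preceq> y"
    then obtain q where q: "agree n c (shift q y)" unfolding pat_le_iff by blast
    obtain k where k: "q \<in> box k" using ex_in_box by blast
    obtain p where p: "p \<notin> box (n + k)" "agree (n + k) y (shift p c)" using far by blast
    have "agree n (shift q y) (shift (q + p) c)" using agree_shift[OF p(2) k] by simp
    then have "agree n c (shift (q + p) c)" using q agree_trans by blast
    then have "shift (q + p) c = c" using n shift_pat_le by blast
    then have "q + p = 0" using c(2) unfolding has_period_direction_iff by blast
    then have "p = - q" by (simp add: eq_neg_iff_add_eq_0 add.commute)
    then have "p \<in> box (n + k)" using k box_mono[of k "n + k"] by simp
    then show False using p(1) by blast
  qed
  ultimately show ?thesis by (simp add: pat_less_iff)
qed

text \<open>Consider the members of \<open>X\<close> that differ from \<open>w\<close> in finitely many places. None of them is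
  isolated: the difference between \<open>c\<close> and \<open>w\<close> can be pasted in at a distant place \<open>q\<close> of the
  period lattice of \<open>w\<close>, with a safety margin of \<open>2 * M\<close> so that each window of radius
  \<open>M\<close> lies in a translate of \<open>c\<close> or of the given member.\<close>

lemma finite_perturbation_uncountable:
  assumes X: "subshift X" and loc: "\<And>z. locally_in M z X \<Longrightarrow> z \<in> X"
    and cw: "c \<in> X" "w \<in> X" "c \<noteq> w" and K0: "\<And>a. a \<notin> box K0 \<Longrightarrow> c a = w a"
    and D: "0 < D" "shift (D, 0) w = w"
  shows "\<not> countable X"
proof
  assume cnt: "countable X"
  define A where "A = {x \<in> X. \<exists>K. \<forall>a. a \<notin> box K \<longrightarrow> x a = w a}"
  have "w \<in> A" using cw by (auto simp: A_def)
  moreover have "A \<subseteq> X" by (auto simp: A_def)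
  ultimately obtain x n where x: "x \<in> A" and isol: "\<forall>z \<in> A. agree n x z \<longrightarrow> z = x"
    using ex_isolated[OF subshift_closed[OF X] cnt, of A] by blast
  obtain K where K: "\<And>a. a \<notin> box K \<Longrightarrow> x a = w a" and xX: "x \<in> X" using x by (auto simp: A_def)
  define m where "m = int (n + K + 2 * M + K0) + 1"
  define q where "q = scale m (D, 0)"
  have "m \<le> m * D" using D(1) by (intro le_mult_pos) (auto simp: m_def)
  then have "m \<le> fst q" by (simp add: q_def)
  then have fq: "int (n + K + 2 * M + K0) < fst q" by (simp add: m_def)
  have sq: "snd q = 0" by (simp add: q_def)
  have wq: "w (a - q) = w a" for a
    using period_scale[OF D(2), of m] unfolding q_def by (metis shift_apply)
  define x' where "x' = (\<lambda>a. if a - q \<in> box K0 then c (a - q) else x a)"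
  have out: "a - q \<notin> box K0" if "a \<in> box (n + K + 2 * M)" for a
    using that fq by (auto simp: in_box)
  have x'c: "x' a = c (a - q)" if "a \<notin> box K" for a
    using that K K0 wq by (simp add: x'_def)
  have "locally_in M x' X"
    unfolding locally_in_def
  proof
    fix p
    show "\<exists>y \<in> X. agree M (shift p x') y"
    proof (cases "\<exists>a \<in> box M. a - p \<in> box K")
      case True
      then obtain a0 where a0: "a0 \<in> box M" "a0 - p \<in> box K" by blast
      have "x' (a - p) = x (a - p)" if a: "a \<in> box M" for a
      proof -
        have "(a0 - p) + (a - a0) \<in> box (K + (M + M))"
          using a0 a by (intro box_add box_diff)
        then have "a - p \<in> box (n + K + 2 * M)"
          using box_mono[of "K + (M + M)" "n + K + 2 * M"] by simp
        then show ?thesis using out by (simp add: x'_def)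
      qed
      then have "agree M (shift p x') (shift p x)" by (simp add: agree_def shift_apply)
      then show ?thesis using subshift_shift[OF X xX] by blast
    next
      case False
      then have "agree M (shift p x') (shift p (shift q c))"
        unfolding agree_def shift_apply using x'c by blast
      then show ?thesis using subshift_shift[OF X] cw(1) by blast
    qed
  qed
  then have "x' \<in> X" by (rule loc)
  moreover have "x' a = w a" if a: "a \<notin> box (K + K0 + nat (fst q))" for a
  proof -
    have "a - q \<notin> box K0"
    proof
      assume "a - q \<in> box K0"
      moreover have "q \<in> box (nat (fst q))" using sq fq by (simp add: in_box)
      ultimately have "a - q + q \<in> box (K0 + nat (fst q))" by (rule box_add)
      then show False using a box_mono[of "K0 + nat (fst q)" "K + K0 + nat (fst q)" a] by simp
    qed
    moreover have "a \<notin> box K" using a box_mono[of K "K + K0 + nat (fst q)" a] by auto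
    ultimately show ?thesis using K by (simp add: x'_def)
  qed
  ultimately have "x' \<in> A" unfolding A_def by blast
  moreover have "agree n x x'"
    unfolding agree_def
  proof
    fix a assume "a \<in> box n"
    then have "a \<in> box (n + K + 2 * M)" by (rule box_mono[rotated]) simp
    then show "x a = x' a" using out by (simp add: x'_def)
  qed
  ultimately have eq: "x' = x" using isol by blast
  obtain a where a: "c a \<noteq> w a" using cw(3) by blast
  then have aK0: "a \<in> box K0" using K0 by blast
  then have "a + q \<notin> box K" using fq by (auto simp: in_box)
  then have "x (a + q) = w (a + q)" using K by blast
  also have "\<dots> = w a" using wq[of "a + q"] by simp
  finally show False using a eq aK0 by (metis x'_def add_diff_cancel_right')
qed

lemma doubly_periodic_axes:
  assumes "doubly_periodic w"
  shows "\<exists>D > 0. shift (D, 0) w = w \<and> shift (0, D) w = w"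
proof -
  obtain u v where uv: "det u v \<noteq> 0" "shift u w = w" "shift v w = w"
    using assms unfolding doubly_periodic_def by blast
  have comb: "shift (scale i u + scale j v) w = w" for i j
    using period_scale[OF uv(2), of i] period_scale[OF uv(3), of j] by (metis shift_shift)
  have "scale (snd v) u + scale (- snd u) v = (det u v, 0)"
    "scale (- fst v) u + scale (fst u) v = (0, det u v)"
    by (simp_all add: prod_eq_iff det_def algebra_simps)
  then have "shift (det u v, 0) w = w" "shift (0, det u v) w = w" using comb by metis+
  then have "shift (\<bar>det u v\<bar>, 0) w = w" "shift (0, \<bar>det u v\<bar>) w = w"
    using period_scale[of "(det u v, 0)" w "sgn (det u v)"]
      period_scale[of "(0, det u v)" w "sgn (det u v)"]
    by (simp_all add: scale_def abs_sgn mult.commute)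
  then show ?thesis using uv(1) by (intro exI[of _ "\<bar>det u v\<bar>"]) simp
qed

text \<open>The complement of a box is connected under steps of length \<open>D\<close>: vertical moves are free to the
  left and right of the box and horizontal moves above and below it, so any two points outside are
  joined through a point \<open>(k * D, l * D)\<close> beyond a corner of the box.\<close>

lemma walk_outside_box:
  assumes step: "\<And>p d. p \<in> G \<Longrightarrow> p \<notin> box \<rho> \<Longrightarrow> d \<in> {(D, 0), (- D, 0), (0, D), (0, - D)} \<Longrightarrow> p + d \<in> G"
    and p: "p \<in> G" "p \<notin> box \<rho>" and q: "p + (i * D, j * D) \<notin> box \<rho>" and D: "0 < D"
  shows "p + (i * D, j * D) \<in> G"
proof -
  have vert: "p + (0, k * D) \<in> G" if "p \<in> G" "int \<rho> < \<bar>fst p\<bar>" for p k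
  proof (induction k rule: int_induct[where k = 0])
    case base
    then show ?case using that by (simp add: zero_prod_def[symmetric])
  next
    case (step1 i)
    have "p + (0, i * D) \<notin> box \<rho>" using that(2) by (simp add: in_box)
    from step[OF step1(2) this, of "(0, D)"] show ?case by (simp add: add.assoc algebra_simps)
  next
    case (step2 i)
    have "p + (0, i * D) \<notin> box \<rho>" using that(2) by (simp add: in_box)
    from step[OF step2(2) this, of "(0, - D)"] show ?case by (simp add: add.assoc algebra_simps)
  qed
  have horiz: "p + (k * D, 0) \<in> G" if "p \<in> G" "int \<rho> < \<bar>snd p\<bar>" for p k
  proof (induction k rule: int_induct[where k = 0])
    case base
    then show ?case using that by (simp add: zero_prod_def[symmetric])
  next
    case (step1 i)
    have "p + (i * D, 0) \<notin> box \<rho>" using that(2) by (simp add: in_box)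
    from step[OF step1(2) this, of "(D, 0)"] show ?case by (simp add: add.assoc algebra_simps)
  next
    case (step2 i)
    have "p + (i * D, 0) \<notin> box \<rho>" using that(2) by (simp add: in_box)
    from step[OF step2(2) this, of "(- D, 0)"] show ?case by (simp add: add.assoc algebra_simps)
  qed
  have far: "\<exists>k. int \<rho> < \<bar>a + k * D\<bar>" for a :: int
  proof -
    have "\<bar>a\<bar> + int \<rho> + 1 \<le> (\<bar>a\<bar> + int \<rho> + 1) * D" using D by (intro le_mult_pos) auto
    then have "int \<rho> < \<bar>a + (\<bar>a\<bar> + int \<rho> + 1) * D\<bar>" by linarith
    then show ?thesis by blast
  qed
  obtain k where k: "int \<rho> < \<bar>fst p + k * D\<bar>" using far by blast
  obtain l where l: "int \<rho> < \<bar>snd p + l * D\<bar>" using far by blast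
  \<comment> \<open>Both coordinates of this point exceed the box, so it can be reached and left in any direction.\<close>
  have corner: "p + (k * D, l * D) \<in> G"
  proof (cases "int \<rho> < \<bar>fst p\<bar>")
    case True
    have "p + (0, l * D) + (k * D, 0) \<in> G" by (rule horiz[OF vert[OF p(1) True]]) (use l in simp)
    then show ?thesis by (simp add: add.assoc)
  next
    case False
    then have "int \<rho> < \<bar>snd p\<bar>" using p(2) by (auto simp: in_box)
    have "p + (k * D, 0) + (0, l * D) \<in> G"
      by (rule vert[OF horiz[OF p(1) \<open>int \<rho> < \<bar>snd p\<bar>\<close>]]) (use k in simp)
    then show ?thesis by (simp add: add.assoc)
  qed
  show ?thesis
  proof (cases "int \<rho> < \<bar>fst p + i * D\<bar>")
    case True
    have "p + (k * D, l * D) + ((i - k) * D, 0) \<in> G" by (rule horiz[OF corner]) (use l in simp)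
    also have "p + (k * D, l * D) + ((i - k) * D, 0) = p + (i * D, l * D)"
      by (simp add: prod_eq_iff algebra_simps)
    finally have "p + (i * D, l * D) + (0, (j - l) * D) \<in> G" by (rule vert) (use True in simp)
    then show ?thesis by (simp add: prod_eq_iff algebra_simps)
  next
    case False
    then have "int \<rho> < \<bar>snd p + j * D\<bar>" using q by (auto simp: in_box)
    have "p + (k * D, l * D) + (0, (j - l) * D) \<in> G" by (rule vert[OF corner]) (use k in simp)
    also have "p + (k * D, l * D) + (0, (j - l) * D) = p + (k * D, j * D)"
      by (simp add: prod_eq_iff algebra_simps)
    finally have "p + (k * D, j * D) + ((i - k) * D, 0) \<in> G"
      by (rule horiz) (use \<open>int \<rho> < \<bar>snd p + j * D\<bar>\<close> in simp)
    then show ?thesis by (simp add: prod_eq_iff algebra_simps)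
  qed
qed

text \<open>Suppose everything below \<open>c\<close> is doubly periodic, and let \<open>w\<close> be isolated among these
  configurations. Far from the origin \<open>c\<close> looks everywhere like something strictly below it. So
  a far occurrence of the isolating window of \<open>w\<close> extends to a larger window of \<open>w\<close> and can be
  moved on by the periods of \<open>w\<close>, all around the origin. Hence \<open>c\<close> differs from a translate of \<open>w\<close>
  in finitely many places only.\<close>

lemma ex_below_not_doubly_periodic:
  fixes X :: "('a :: finite) config set"
  assumes X: "subshift X" "countable X" and loc: "\<And>z. locally_in M z X \<Longrightarrow> z \<in> X"
    and c: "c \<in> X" "\<not> has_period_direction c"
  shows "\<exists>y. y \<prec> c \<and> \<not> doubly_periodic y"
proof (rule ccontr)
  assume "\<not> ?thesis"
  then have dbl: "\<And>y. y \<prec> c \<Longrightarrow> doubly_periodic y" by blast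
  note below = limit_at_infinity_below[OF X c]
  have far: "\<exists>\<rho>. \<forall>p. p \<notin> box \<rho> \<longrightarrow> (\<exists>y. y \<prec> c \<and> agree R (shift p c) y)" for R
  proof (rule ccontr)
    assume "\<not> ?thesis"
    then have "\<forall>\<rho>. \<exists>p. p \<notin> box \<rho> \<and> (\<forall>y. y \<prec> c \<longrightarrow> \<not> agree R (shift p c) y)" by blast
    then obtain p where p: "\<forall>\<rho>. p \<rho> \<notin> box \<rho> \<and> (\<forall>y. y \<prec> c \<longrightarrow> \<not> agree R (shift (p \<rho>) c) y)"
      by (rule choice[THEN exE])
    obtain y where y: "\<And>n. \<exists>m \<ge> n. agree n y (shift (p m) c)"
      using compactness[of "\<lambda>m. shift (p m) c"] by blast
    have "y \<prec> c"
    proof (rule below)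
      fix n
      obtain m where "m \<ge> n" "agree n y (shift (p m) c)" using y by blast
      then show "\<exists>p. p \<notin> box n \<and> agree n y (shift p c)" using p box_mono by blast
    qed
    then show False using y[of R] p agree_sym by blast
  qed
  \<comment> \<open>Something lies strictly below \<open>c\<close>, since there are points outside every box.\<close>
  obtain y0 where "y0 \<prec> c"
  proof -
    have "(int (Suc \<rho>), 0) \<notin> box \<rho>" for \<rho> by (simp add: in_box)
    then show thesis using far[of 0] that by blast
  qed
  then have "{y. y \<prec> c} \<noteq> {}" by blast
  moreover have "{y. y \<prec> c} \<subseteq> X"
    using pat_le_in_subshift[OF X(1) c(1)] by (auto simp: pat_less_iff)
  ultimately obtain w n where w: "w \<prec> c" and isol: "\<forall>y. y \<prec> c \<longrightarrow> agree n w y \<longrightarrow> y = w"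
    using ex_isolated[OF subshift_closed[OF X(1)] X(2), of "{y. y \<prec> c}"] by blast
  obtain D where D: "0 < D" "shift (D, 0) w = w" "shift (0, D) w = w"
    using doubly_periodic_axes[OF dbl[OF w]] by blast
  define R where "R = n + nat D"
  obtain \<rho> where \<rho>: "\<And>p. p \<notin> box \<rho> \<Longrightarrow> \<exists>y. y \<prec> c \<and> agree R (shift p c) y" using far by blast
  \<comment> \<open>The places where \<open>c\<close> shows the isolating window of \<open>w\<close>.\<close>
  define G where "G = {p. agree n w (shift p c)}"
  have grow: "agree R w (shift p c)" if p: "p \<in> G" "p \<notin> box \<rho>" for p
  proof -
    obtain y where y: "y \<prec> c" "agree R (shift p c) y" using \<rho>[OF p(2)] by blast
    have "agree n (shift p c) y" using y(2) by (rule agree_mono) (simp add: R_def)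
    then have "agree n w y" using p(1) agree_trans unfolding G_def by blast
    then show ?thesis using isol y agree_sym by blast
  qed
  obtain p0 where p0: "p0 \<in> G" "p0 \<notin> box \<rho>"
  proof (rule ccontr)
    assume "\<not> thesis"
    then have "G \<subseteq> box \<rho>" using that by blast
    have "\<exists>q \<in> box \<rho>. agree m w (shift q c)" for m
    proof -
      obtain q where q: "agree (max m n) w (shift q c)" using w unfolding pat_less_iff pat_le_iff by blast
      then have "agree m w (shift q c)" "agree n w (shift q c)" by (auto intro: agree_mono)
      then show ?thesis using \<open>G \<subseteq> box \<rho>\<close> unfolding G_def by blast
    qed
    then obtain q where "w = shift q c" using agree_all_shift_of_finite[OF finite_box] by blast
    then show False using w pat_le_shift[of c q] by (simp add: pat_less_iff)
  qed
  have step: "p + d \<in> G" if p: "p \<in> G" "p \<notin> box \<rho>" and d: "d \<in> {(D, 0), (- D, 0), (0, D), (0, - D)}" for p d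
  proof -
    have "shift d w = w"
      using d D(2,3) shift_uminus_period[OF D(2)] shift_uminus_period[OF D(3)] by auto
    moreover have "d \<in> box (nat D)" using d D(1) by (auto simp: in_box)
    then have "agree n (shift d w) (shift d (shift p c))"
      using agree_shift[OF grow[OF p]] by (simp add: R_def)
    ultimately show ?thesis by (simp add: G_def add.commute)
  qed
  define w0 where "w0 = shift (- p0) w"
  have c_w0: "c a = w0 a" if a: "a \<notin> box (\<rho> + nat D)" for a
  proof -
    define b where "b = (fst (a + p0) mod D, snd (a + p0) mod D)"
    define i j where "i = - (fst (a + p0) div D)" and "j = - (snd (a + p0) div D)"
    have b: "b = a + (p0 + (i * D, j * D))"
      by (simp add: b_def i_def j_def prod_eq_iff minus_mult_div_eq_mod[symmetric] algebra_simps)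
    have bD: "b \<in> box (nat D)"
      using D(1) pos_mod_bound[OF D(1)] pos_mod_sign[OF D(1)]
      by (auto simp: in_box b_def less_imp_le)
    have qout: "p0 + (i * D, j * D) \<notin> box \<rho>"
    proof
      assume "p0 + (i * D, j * D) \<in> box \<rho>"
      then have "b - (p0 + (i * D, j * D)) \<in> box (nat D + \<rho>)" using bD by (intro box_diff)
      then show False using a b by (simp add: add.commute)
    qed
    have "p0 + (i * D, j * D) \<in> G"
      by (rule walk_outside_box[OF step p0 qout D(1)])
    then have "agree R w (shift (p0 + (i * D, j * D)) c)" using grow qout by blast
    moreover have "b \<in> box R" using bD box_mono[of "nat D" R] by (simp add: R_def)
    ultimately have "w b = c (b - (p0 + (i * D, j * D)))" by (simp add: agree_def shift_apply)
    then have "c a = w b" using b by simp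
    also have "w b = w (a + p0 + scale i (D, 0) + scale j (0, D))"
      unfolding b by (rule arg_cong[of _ _ w]) (simp add: prod_eq_iff)
    also have "\<dots> = w (a + p0)"
      using period_scale[OF D(2), of i] period_scale[OF D(3), of j] unfolding period_iff by metis
    finally show ?thesis by (simp add: w0_def shift_apply)
  qed
  have w0X: "w0 \<in> X" unfolding w0_def
    using subshift_shift[OF X(1)] pat_le_in_subshift[OF X(1) c(1)] w by (auto simp: pat_less_iff)
  have w0D: "shift (D, 0) w0 = w0" unfolding w0_def using D(2) period_shift_iff by metis
  moreover have "(D, 0) \<noteq> (0 :: int \<times> int)" using D(1) by (simp add: zero_prod_def)
  ultimately have "c \<noteq> w0" using c(2) unfolding has_period_direction_iff by blast
  then have "\<not> countable X"
    using finite_perturbation_uncountable[OF X(1) loc c(1) w0X _ c_w0 D(1) w0D] by blast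
  then show False using X(2) by contradiction
qed

section \<open>Levels\<close>

text \<open>Initial segments of chains are chains, so the lengths that occur form an initial segment of the
  natural numbers, and a finite lower bound on their supremum is attained.\<close>

lemma level_ge_iff:
  assumes "c \<in> X"
  shows "enat n \<le> level X c \<longleftrightarrow> (\<exists>s. decreasing_chain X c n s)"
proof
  assume "\<exists>s. decreasing_chain X c n s"
  then show "enat n \<le> level X c" unfolding level_def by (intro SUP_upper) simp
next
  assume le: "enat n \<le> level X c"
  show "\<exists>s. decreasing_chain X c n s"
  proof (rule ccontr)
    assume no: "\<nexists>s. decreasing_chain X c n s"
    have "decreasing_chain X c 0 (\<lambda>_. c)" using assms by (simp add: decreasing_chain_def)
    then have "n \<noteq> 0" using no by metis
    have "m \<le> n - 1" if "decreasing_chain X c m s" for m s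
    proof (rule ccontr)
      assume "\<not> m \<le> n - 1"
      then have "decreasing_chain X c n s" using that by (auto simp: decreasing_chain_def)
      then show False using no by blast
    qed
    then have "level X c \<le> enat (n - 1)" unfolding level_def by (intro SUP_least) auto
    then have "enat n \<le> enat (n - 1)" using le order_trans by blast
    then show False using \<open>n \<noteq> 0\<close> by simp
  qed
qed

theorem theorem4p10:
  fixes X :: "('a :: finite) config set"
  assumes "subshift_of_finite_type X"
    and "countable X"
  shows "(\<exists>x \<in> X. \<not> has_period_direction x) \<longleftrightarrow> (\<exists>c \<in> X. level X c = 2)"
proof -
  note X = sft_locally_determined(1)[OF assms(1)] assms(2)
  obtain M where loc: "\<And>z. locally_in M z X \<Longrightarrow> z \<in> X"
    using sft_locally_determined(2)[OF assms(1)] by blast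
  show ?thesis
  proof
    assume "\<exists>x \<in> X. \<not> has_period_direction x"
    then obtain c where c: "c \<in> X" "\<not> has_period_direction c"
        "\<And>y. y \<prec> c \<Longrightarrow> has_period_direction y"
      using ex_minimal_aperiodic[OF X] by blast
    have in_X: "y \<in> X" if "y \<prec> x" "x \<in> X" for x y
      using that pat_le_in_subshift[OF X(1)] by (auto simp: pat_less_iff)
    obtain y where y: "y \<prec> c" "\<not> doubly_periodic y"
      using ex_below_not_doubly_periodic[OF X loc c(1,2)] by blast
    obtain z where z: "z \<prec> y"
      using singly_periodic_not_minimal[OF X loc in_X[OF y(1) c(1)] c(3)[OF y(1)] y(2)] by blast
    have "decreasing_chain X c 2 (\<lambda>i. if i = 0 then c else if i = 1 then y else z)"
      using y(1) z c(1) in_X[OF y(1) c(1)] in_X[OF z in_X[OF y(1) c(1)]]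
      by (auto simp: decreasing_chain_def less_2_cases_iff)
    then have "enat 2 \<le> level X c" using level_ge_iff[OF c(1)] by blast
    moreover have "\<not> enat 3 \<le> level X c"
    proof
      assume "enat 3 \<le> level X c"
      then obtain s where "decreasing_chain X c 3 s" using level_ge_iff[OF c(1)] by blast
      then have s: "s 1 \<prec> c" "s 2 \<prec> s 1" "s 3 \<prec> s 2"
        by (auto simp: decreasing_chain_def numeral_eq_Suc)
      show False
        using periodic_no_chain[OF X loc in_X[OF s(1) c(1)] c(3)[OF s(1)] s(2,3)] .
    qed
    ultimately have "level X c = 2" by (cases "level X c") (auto simp: numeral_eq_enat)
    then show "\<exists>c \<in> X. level X c = 2" using c(1) by blast
  next
    assume "\<exists>c \<in> X. level X c = 2"
    then obtain c where c: "c \<in> X" "level X c = 2" by blast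
    then have "enat 2 \<le> level X c" by (simp add: numeral_eq_enat)
    then obtain s where "decreasing_chain X c 2 s" using level_ge_iff[OF c(1)] by blast
    then have s: "s 1 \<prec> c" "s 2 \<prec> s 1" by (auto simp: decreasing_chain_def numeral_eq_Suc)
    have "\<not> has_period_direction c" using periodic_no_chain[OF X loc c(1) _ s] by blast
    then show "\<exists>x \<in> X. \<not> has_period_direction x" using c(1) by blast
  qed
qed

end
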